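(* Suppose that $f$ and $h$ obey Gaussian processes as described in the context. For any $x\in\mathcal{X}$ and any $\gamma\in\mathbb{R}$, $$\mathrm{Pr}\big(f(x)\le\gamma \,\big|\, x,\mathcal{D}\big) = 1-\delta(\gamma,x,\mathcal{D}),$$ where $$\delta(\gamma,x,\mathcal{D}) := \frac12\,\mathbb{E}\left[\mathrm{erfc}\left(\frac{\gamma-k_D(x)^\top \widetilde K(h_{1:D})^{-1} y^{\mathrm E}_{1:D}}{\sqrt{2}\,\sqrt{k(x,x)-k_D(x)^\top\widetilde K(h_{1:D})^{-1}k_D(x)}}\right)\,\middle|\, x,\mathcal{D}\right].$$
   Context: Data model. Let $\mathcal{X}\subseteq\mathbb{R}^n$, and let $f:\mathcal{X}\to\mathbb{R}$ and $g:\mathcal{X}\to(0,\infty)$ be unknown (random) functions; put $h(x):=\ln g(x)^2$. Let $x_1,\dots,x_D\in\mathcal{X}$ be $D$ given (deterministic) pairwise distinct training inputs. For each $d\in\{1,\dots,D\}$ one observes $S\ge 1$ outputs $y_{d,s}=f(x_d)+w_{d,s}$, $s\in\{1,\dots,S\}$, where $w_{d,s}\mid g(x_d)\sim\mathcal{N}(0,g(x_d)^2)$; the normalized noises $w_{d,s}/g(x_d)$ are i.i.d. $\mathcal{N}(0,1)$ over all $(d,s)$ and independent of $(f,h)$. Gaussian process assumption. $f$ and $h$ are independent zero-mean Gaussian processes with strictly positive definite kernels $k:\mathcal{X}\times\mathcal{X}\to\mathbb{R}$ and $\ell:\mathcal{X}\times\mathcal{X}\to\mathbb{R}$, respectively: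 for any natural number $N$ and any distinct points $x_1',\dots,x_N'\in\mathcal{X}$, the Gram matrices $(k(x_i',x_j'))_{i,j}$ and $(\ell(x_i',x_j'))_{i,j}$ are positive definite; given any $h$, $[f(x_1'),\dots,f(x_N')]^\top\sim\mathcal{N}(0,(k(x_i',x_j'))_{i,j})$; and given any $f$, $[h(x_1'),\dots,h(x_N')]^\top\sim\mathcal{N}(0,(\ell(x_i',x_j'))_{i,j})$. Notation. $k_D(x):=[k(x,x_1),\dots,k(x,x_D)]^\top\in\mathbb{R}^D$; $K_D:=(k(x_i,x_j))_{i,j=1}^D$; $y^{\mathrm E}_d:=\frac1S\sum_{s=1}^S y_{d,s}$; $y^{\mathrm E}_{1:D}:=[y^{\mathrm E}_1,\dots,y^{\mathrm E}_D]^\top$; $h_d:=h(x_d)$; $h_{1:D}:=[h_1,\dots,h_D]^\top$; $\widetilde K(h_{1:D}):=K_D+\frac1S\,\mathrm{diag}(\exp h_1,\dots,\exp h_D)$. The dataset is $\mathcal{D}:=[x_{1:D},y^{\mathrm E}_{1:D}]$; since the inputs are deterministic, conditioning on $\mathcal{D}$ means conditioning on $y^{\mathrm E}_{1:D}$. The expectation defining $\delta$ is with respect to the conditional law of $h_{1:D}$ given $\mathcal{D}$. The complementary error function is $\mathrm{erfc}(a):=\frac{2}{\sqrt\pi}\int_a^\infty \exp(-t^2)\,dt$. *)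

theory Defs
  imports
    "HOL-Probability.Probability"
    "Jordan_Normal_Form.Gauss_Jordan_Elimination"
    "Jordan_Normal_Form.Determinant"
begin

text \<open>
  Vectors and matrices whose size is a natural number are those of Jordan_Normal_Form, with indices
  starting at 0.  Its constants \<open>vec\<close>, \<open>mat\<close> and \<open>det\<close> are qualified because HOL-Analysis has its
  own versions, and \<open>\<bullet>\<close> is reserved for its scalar product.
\<close>

no_notation inner (infix \<open>\<bullet>\<close> 70)

definition erfc :: "real \<Rightarrow> real" where
  "erfc a = 2 / sqrt pi * (LBINT t:{a..}. exp (- t\<^sup>2))"

text \<open>Only meaningful for invertible square matrices; \<^const>\<open>mat_inverse\<close> returns \<^const>\<open>None\<close> otherwise.\<close>

definition inv_mat :: "real mat \<Rightarrow> real mat" where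
  "inv_mat A = the (mat_inverse A)"

definition pos_def_mat :: "nat \<Rightarrow> real mat \<Rightarrow> bool" where
  "pos_def_mat N A \<longleftrightarrow>
     A \<in> carrier_mat N N \<and> transpose_mat A = A \<and>
     (\<forall>v \<in> carrier_vec N. v \<noteq> 0\<^sub>v N \<longrightarrow> v \<bullet> (A *\<^sub>v v) > 0)"

definition gram_mat :: "('a \<Rightarrow> 'a \<Rightarrow> real) \<Rightarrow> nat \<Rightarrow> (nat \<Rightarrow> 'a) \<Rightarrow> real mat" where
  "gram_mat k N p = Matrix.mat N N (\<lambda>(i, j). k (p i) (p j))"

definition strictly_pos_def_kernel :: "'a set \<Rightarrow> ('a \<Rightarrow> 'a \<Rightarrow> real) \<Rightarrow> bool" where
  "strictly_pos_def_kernel X k \<longleftrightarrow>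
     (\<forall>N p. inj_on p {..<N} \<and> p ` {..<N} \<subseteq> X \<longrightarrow> pos_def_mat N (gram_mat k N p))"

text \<open>
  Lebesgue density of the centred normal distribution on \<open>\<real>\<^sup>N\<close> with positive definite covariance
  matrix \<open>C\<close>.  Points of \<open>\<real>\<^sup>N\<close> are elements of \<open>\<Pi>\<^sub>E i\<in>{..<N}. UNIV\<close>, so that \<open>\<Pi>\<^sub>M i\<in>{..<N}. lborel\<close>
  is the Lebesgue measure.
\<close>

definition mvn_density :: "nat \<Rightarrow> real mat \<Rightarrow> (nat \<Rightarrow> real) \<Rightarrow> real" where
  "mvn_density N C v =
     exp (- (Matrix.vec N v \<bullet> (inv_mat C *\<^sub>v Matrix.vec N v)) / 2)
       / sqrt ((2 * pi) ^ N * Determinant.det C)"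

definition multivariate_normal ::
    "'w measure \<Rightarrow> nat \<Rightarrow> ('w \<Rightarrow> nat \<Rightarrow> real) \<Rightarrow> real mat \<Rightarrow> bool" where
  "multivariate_normal M N Z C \<longleftrightarrow>
     distributed M (\<Pi>\<^sub>M i\<in>{..<N}. lborel) Z (\<lambda>v. ennreal (mvn_density N C v))"

definition gaussian_process ::
    "'w measure \<Rightarrow> 'a set \<Rightarrow> ('a \<Rightarrow> 'a \<Rightarrow> real) \<Rightarrow> ('a \<Rightarrow> 'w \<Rightarrow> real) \<Rightarrow> bool" where
  "gaussian_process M X k F \<longleftrightarrow>
     strictly_pos_def_kernel X k \<and>
     (\<forall>x\<in>X. F x \<in> borel_measurable M) \<and>
     (\<forall>N p. inj_on p {..<N} \<and> p ` {..<N} \<subseteq> X \<longrightarrow>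
        multivariate_normal M N (\<lambda>\<omega>. \<lambda>i\<in>{..<N}. F (p i) \<omega>) (gram_mat k N p))"

definition path_on :: "'a set \<Rightarrow> ('a \<Rightarrow> 'w \<Rightarrow> real) \<Rightarrow> 'w \<Rightarrow> 'a \<Rightarrow> real" where
  "path_on X F \<omega> = (\<lambda>x\<in>X. F x \<omega>)"

abbreviation path_space :: "'a set \<Rightarrow> ('a \<Rightarrow> real) measure" where
  "path_space X \<equiv> (\<Pi>\<^sub>M x\<in>X. borel)"

definition log_var :: "('a \<Rightarrow> 'w \<Rightarrow> real) \<Rightarrow> 'a \<Rightarrow> 'w \<Rightarrow> real" where
  "log_var g x \<omega> = ln ((g x \<omega>)\<^sup>2)"

definition emp_mean :: "nat \<Rightarrow> (nat \<Rightarrow> nat \<Rightarrow> 'w \<Rightarrow> real) \<Rightarrow> nat \<Rightarrow> 'w \<Rightarrow> real" where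
  "emp_mean S y d \<omega> = (\<Sum>s<S. y d s \<omega>) / real S"

definition data_algebra ::
    "'w measure \<Rightarrow> nat \<Rightarrow> nat \<Rightarrow> (nat \<Rightarrow> nat \<Rightarrow> 'w \<Rightarrow> real) \<Rightarrow> 'w measure" where
  "data_algebra M D S y =
     vimage_algebra (space M) (\<lambda>\<omega>. \<lambda>d\<in>{..<D}. emp_mean S y d \<omega>) (\<Pi>\<^sub>M d\<in>{..<D}. borel)"

definition k_vec :: "('a \<Rightarrow> 'a \<Rightarrow> real) \<Rightarrow> nat \<Rightarrow> (nat \<Rightarrow> 'a) \<Rightarrow> 'a \<Rightarrow> real vec" where
  "k_vec k D xs x = Matrix.vec D (\<lambda>d. k x (xs d))"

definition K_tilde ::
    "('a \<Rightarrow> 'a \<Rightarrow> real) \<Rightarrow> nat \<Rightarrow> nat \<Rightarrow> (nat \<Rightarrow> 'a) \<Rightarrow> (nat \<Rightarrow> real) \<Rightarrow> real mat" where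
  "K_tilde k D S xs hs = gram_mat k D xs + (1 / real S) \<cdot>\<^sub>m mat_diag D (\<lambda>d. exp (hs d))"

definition post_mean ::
    "('a \<Rightarrow> 'a \<Rightarrow> real) \<Rightarrow> nat \<Rightarrow> nat \<Rightarrow> (nat \<Rightarrow> 'a) \<Rightarrow> 'a \<Rightarrow> (nat \<Rightarrow> real) \<Rightarrow> (nat \<Rightarrow> real) \<Rightarrow> real" where
  "post_mean k D S xs x hs ys =
     k_vec k D xs x \<bullet> (inv_mat (K_tilde k D S xs hs) *\<^sub>v Matrix.vec D ys)"

definition post_var ::
    "('a \<Rightarrow> 'a \<Rightarrow> real) \<Rightarrow> nat \<Rightarrow> nat \<Rightarrow> (nat \<Rightarrow> 'a) \<Rightarrow> 'a \<Rightarrow> (nat \<Rightarrow> real) \<Rightarrow> real" where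
  "post_var k D S xs x hs =
     k x x - k_vec k D xs x \<bullet> (inv_mat (K_tilde k D S xs hs) *\<^sub>v k_vec k D xs x)"

text \<open>As a conditional expectation, \<open>delta\<close> is a random variable; it is determined almost surely.\<close>

definition delta ::
    "'w measure \<Rightarrow> ('a \<Rightarrow> 'a \<Rightarrow> real) \<Rightarrow> nat \<Rightarrow> nat \<Rightarrow> (nat \<Rightarrow> 'a) \<Rightarrow> ('a \<Rightarrow> 'w \<Rightarrow> real)
      \<Rightarrow> (nat \<Rightarrow> nat \<Rightarrow> 'w \<Rightarrow> real) \<Rightarrow> real \<Rightarrow> 'a \<Rightarrow> 'w \<Rightarrow> real" where
  "delta M k D S xs h y \<gamma> x \<omega> =
     1 / 2 * real_cond_exp M (data_algebra M D S y)
       (\<lambda>\<omega>'. erfc ((\<gamma> - post_mean k D S xs x (\<lambda>d. h (xs d) \<omega>') (\<lambda>d. emp_mean S y d \<omega>'))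
                    / (sqrt 2 * sqrt (post_var k D S xs x (\<lambda>d. h (xs d) \<omega>'))))) \<omega>"

end

theory Submission
  imports Defs "HOL-Complex_Analysis.Cauchy_Integral_Formula"
begin

text \<open>
  Given the log variances \<open>h\<^sub>1, \<dots>, h\<^sub>D\<close>, the averaged outputs are \<open>f (x\<^sub>d) + exp (h\<^sub>d / 2) * e\<^sub>d\<close> with
  independent normal \<open>e\<^sub>d\<close> of variance \<open>1 / S\<close>.  Jointly with \<open>f x\<close> they form a centred normal vector, with
  covariance matrix \<open>K\<close> (the matrix \<^const>\<open>K_tilde\<close>) of the outputs and covariances \<open>\<kappa>\<close> with \<open>f x\<close>.  Hence
  \<open>f x\<close> is, given outputs and log variances, normal with mean \<open>\<kappa> \<bullet> K\<inverse> Y\<close> and variance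
  \<open>k x x - \<kappa> \<bullet> K\<inverse> \<kappa>\<close>, and the probability of \<open>f x \<le> \<gamma>\<close> is \<open>1 - erfc (\<dots>) / 2\<close>.  Integrating out the log
  variances gives, for every event \<open>B\<close> of the data algebra, equal integrals over \<open>B\<close> of the indicator of
  \<open>f x \<le> \<gamma>\<close> and of \<open>1 - erfc (\<dots>) / 2\<close>, which characterizes the conditional expectation.

  Normal laws are handled through moment generating functions.  These are nonnegative integrals that can
  be computed without integrability conditions, and a measure on a finite power of \<open>\<real>\<close> with everywhere
  finite moment generating function is determined by it (\<open>PiM_measure_eqI_mgf\<close>).  For a density of the form
  \<^const>\<open>mvn_density\<close> the function is found by completing the square and translating
  (\<open>multivariate_normal_mgf\<close>).  Conditioning in a normal vector then becomes an identity of quadratic forms: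
  the pair \<open>(Y, f x)\<close> and the pair of \<open>Y\<close> and the posterior mean plus independent normal noise have the same
  moment generating function, hence the same law (\<open>conditional_law\<close>).

  This argument works for fixed noise variances.  As \<open>h\<close> is independent of \<open>f\<close> and of the normalized noises
  together, it can be sampled first and then held fixed (\<open>conditional_prob_random_noise\<close>).
\<close>

section \<open>Finite measures are determined by their moment generating functions\<close>

text \<open>A moment generating function that is finite on the whole line makes all exponential moments of
  \<open>\<bar>u\<bar>\<close> finite, so that the exponential series can be integrated term by term at real and at imaginary
  arguments alike.  Both the moment generating function and the characteristic function are then power
  series in the moments.\<close>

lemma mgf_power_series:
  fixes M :: "real measure"
  assumes "real_distribution M"
    and fin: "\<And>s. (\<integral>\<^sup>+u. ennreal (exp (s * u)) \<partial>M) < \<infinity>"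
  shows "integrable M (\<lambda>u. exp (s * u))"
    and "(\<lambda>n. (LINT u|M. u ^ n) / fact n * s ^ n) sums (LINT u|M. exp (s * u))"
    and "(\<lambda>n. complex_of_real ((LINT u|M. u ^ n) / fact n) * (\<i> * complex_of_real s) ^ n) sums char M s"
proof -
  interpret real_distribution M by fact
  have int: "integrable M (\<lambda>u. exp (s * u))" for s
    using fin[of s] by (intro integrableI_bounded) auto
  show "integrable M (\<lambda>u. exp (s * u))" by (rule int)
  have int_abs: "integrable M (\<lambda>u. exp (\<bar>r\<bar> * \<bar>u\<bar>))" for r :: real
  proof (rule Bochner_Integration.integrable_bound)
    show "integrable M (\<lambda>u. exp (r * u) + exp (- r * u))"
      by (intro Bochner_Integration.integrable_add int)
    have "exp (\<bar>r\<bar> * \<bar>u\<bar>) \<le> exp (r * u) + exp (- r * u)" for u :: real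
    proof -
      have "\<bar>r\<bar> * \<bar>u\<bar> = r * u \<or> \<bar>r\<bar> * \<bar>u\<bar> = - r * u" by (auto simp: abs_mult[symmetric] abs_if)
      then show ?thesis by (auto intro: less_imp_le)
    qed
    then show "AE u in M. norm (exp (\<bar>r\<bar> * \<bar>u\<bar>)) \<le> norm (exp (r * u) + exp (- r * u))"
      by (intro AE_I2) (auto intro!: order_trans[OF _ abs_ge_self])
  qed simp
  \<comment> \<open>The bound \<open>\<Sum>\<^sub>n \<bar>r u\<bar>\<^sup>n / n! = exp \<bar>r u\<bar>\<close> lets the exponential series be integrated termwise.\<close>
  have sums_abs: "(\<lambda>n. \<bar>r * u\<bar> ^ n / fact n) sums exp (\<bar>r\<bar> * \<bar>u\<bar>)" for r u :: real
    using exp_converges[of "\<bar>r\<bar> * \<bar>u\<bar>"] by (simp add: abs_mult divide_inverse mult.commute)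
  have le_exp: "\<bar>r * u\<bar> ^ n / fact n \<le> exp (\<bar>r\<bar> * \<bar>u\<bar>)" for r u :: real and n
    using sum_le_suminf[OF sums_summable[OF sums_abs], of "{n}" r u] sums_unique[OF sums_abs[of r u]] by auto
  have int_pow: "integrable M (\<lambda>u. \<bar>r * u\<bar> ^ n / fact n)" for r n
    by (rule Bochner_Integration.integrable_bound[OF int_abs[of r]]) (use le_exp[of r] in auto)
  have summ: "summable (\<lambda>n. LINT u|M. \<bar>r * u\<bar> ^ n / fact n)" for r
  proof (rule bounded_imp_summable)
    show "0 \<le> (LINT u|M. \<bar>r * u\<bar> ^ n / fact n)" for n by simp
    fix n
    have "(\<Sum>k\<le>n. LINT u|M. \<bar>r * u\<bar> ^ k / fact k) = (LINT u|M. (\<Sum>k\<le>n. \<bar>r * u\<bar> ^ k / fact k))"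
      by (rule Bochner_Integration.integral_sum[symmetric]) (rule int_pow)
    also have "\<dots> \<le> (LINT u|M. exp (\<bar>r\<bar> * \<bar>u\<bar>))"
    proof (rule integral_mono)
      show "integrable M (\<lambda>u. \<Sum>k\<le>n. \<bar>r * u\<bar> ^ k / fact k)" by (intro Bochner_Integration.integrable_sum int_pow)
      show "(\<Sum>k\<le>n. \<bar>r * u\<bar> ^ k / fact k) \<le> exp (\<bar>r\<bar> * \<bar>u\<bar>)" for u
        unfolding sums_unique[OF sums_abs[of r u]]
        by (rule sum_le_suminf[OF sums_summable[OF sums_abs]]) auto
    qed (rule int_abs)
    finally show "(\<Sum>k\<le>n. LINT u|M. \<bar>r * u\<bar> ^ k / fact k) \<le> (LINT u|M. exp (\<bar>r\<bar> * \<bar>u\<bar>))" .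
  qed
  have "(\<lambda>n. LINT u|M. (s * u) ^ n / fact n) sums (LINT u|M. (\<Sum>n. (s * u) ^ n / fact n))"
  proof (rule sums_integral)
    show "integrable M (\<lambda>u. (s * u) ^ n / fact n)" for n
      by (rule Bochner_Integration.integrable_bound[OF int_pow[of s n]]) (auto simp: power_abs)
    show "AE u in M. summable (\<lambda>n. norm ((s * u) ^ n / fact n))"
      by (intro AE_I2) (use sums_summable[OF sums_abs] in \<open>simp add: power_abs\<close>)
    show "summable (\<lambda>n. LINT u|M. norm ((s * u) ^ n / fact n))"
      using summ[of s] by (simp add: power_abs)
  qed
  moreover have "(\<Sum>n. (s * u) ^ n / fact n) = exp (s * u)" for u
    unfolding exp_def by (simp add: divide_inverse mult.commute)
  moreover have "(LINT u|M. (s * u) ^ n / fact n) = (LINT u|M. u ^ n) / fact n * s ^ n" for n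
    by (simp add: power_mult_distrib)
  ultimately show "(\<lambda>n. (LINT u|M. u ^ n) / fact n * s ^ n) sums (LINT u|M. exp (s * u))" by simp
  have "(\<lambda>n. CLINT u|M. (\<i> * of_real (s * u)) ^ n / fact n) sums (CLINT u|M. (\<Sum>n. (\<i> * of_real (s * u)) ^ n / fact n))"
  proof (rule sums_integral)
    show "integrable M (\<lambda>u. (\<i> * complex_of_real (s * u)) ^ n / fact n)" for n
      by (rule Bochner_Integration.integrable_bound[OF int_pow[of s n]])
         (auto simp: norm_power norm_divide norm_mult abs_mult)
    show "AE u in M. summable (\<lambda>n. norm ((\<i> * complex_of_real (s * u)) ^ n / fact n))"
      by (intro AE_I2) (use sums_summable[OF sums_abs] in \<open>simp add: norm_power norm_divide norm_mult abs_mult\<close>)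
    show "summable (\<lambda>n. LINT u|M. norm ((\<i> * complex_of_real (s * u)) ^ n / fact n))"
      using summ[of s] by (simp add: norm_power norm_divide norm_mult abs_mult)
  qed
  moreover have "(\<Sum>n. (\<i> * complex_of_real (s * u)) ^ n / fact n) = iexp (s * u)" for u
    unfolding exp_def by (simp add: scaleR_conv_of_real divide_inverse mult.commute)
  moreover have "(CLINT u|M. (\<i> * of_real (s * u)) ^ n / fact n)
      = complex_of_real ((LINT u|M. u ^ n) / fact n) * (\<i> * of_real s) ^ n" for n
  proof -
    have "(CLINT u|M. (\<i> * of_real (s * u)) ^ n / fact n)
        = (CLINT u|M. ((\<i> * of_real s) ^ n / fact n) * complex_of_real (u ^ n))"
      by (rule Bochner_Integration.integral_cong) (simp_all add: power_mult_distrib)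
    also have "\<dots> = (\<i> * of_real s) ^ n / fact n * complex_of_real (LINT u|M. u ^ n)"
      by (simp only: integral_mult_right_zero integral_complex_of_real)
    finally show ?thesis by simp
  qed
  ultimately show "(\<lambda>n. complex_of_real ((LINT u|M. u ^ n) / fact n) * (\<i> * complex_of_real s) ^ n) sums char M s"
    unfolding char_def by simp
qed

text \<open>The moments are the coefficients of an everywhere convergent power series, hence determined by its
  values; they in turn determine the characteristic function, to which Levy's uniqueness theorem applies.\<close>

lemma prob_eqI_mgf:
  fixes M N :: "real measure"
  assumes M: "real_distribution M" and N: "real_distribution N"
    and fin: "\<And>s. (\<integral>\<^sup>+u. ennreal (exp (s * u)) \<partial>M) < \<infinity>"
    and eq: "\<And>s. (\<integral>\<^sup>+u. ennreal (exp (s * u)) \<partial>M) = (\<integral>\<^sup>+u. ennreal (exp (s * u)) \<partial>N)"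
  shows "M = N"
proof (rule Levy_uniqueness[OF M N])
  note psM = mgf_power_series[OF M fin]
  note psN = mgf_power_series[OF N fin[unfolded eq]]
  define a where "a n = (LINT u|M. u ^ n) / fact n - (LINT u|N. u ^ n) / fact n" for n
  have "(LINT u|M. exp (s * u)) = (LINT u|N. exp (s * u))" for s
    using nn_integral_eq_integral[OF psM(1)[of s]] nn_integral_eq_integral[OF psN(1)[of s]] eq[of s] by simp
  then have sums0: "(\<lambda>n. a n * s ^ n) sums 0" for s
    using sums_diff[OF psM(2)[of s] psN(2)[of s]] by (simp add: a_def left_diff_distrib)
  have a0: "a m = 0" if "m > 0" for m
  proof (rule ccontr)
    assume "a m \<noteq> 0"
    show False
    proof (rule powser_0_nonzero[of 1 0 a "\<lambda>_. 0 :: real" m])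
      fix s :: real assume "0 < s" and s: "\<And>z. z \<in> cball 0 s - {0 :: real} \<Longrightarrow> (0 :: real) \<noteq> 0"
      then show False using s[of s] by simp
    qed (use sums0 that \<open>a m \<noteq> 0\<close> in auto)
  qed
  then have "a m = 0" for m
  proof (cases m)
    case 0
    then show ?thesis using sums0[of 0] by simp
  qed simp
  then have "(LINT u|M. u ^ n) / fact n = (LINT u|N. u ^ n) / fact n" for n
    unfolding a_def by (simp add: field_simps)
  then have "char M s = char N s" for s
    using psM(3)[of s] psN(3)[of s] sums_unique2 by simp
  then show "char M = char N" by auto
qed

text \<open>Both measures have the same mass, the value of the moment generating function at \<open>0\<close>, and dividing by
  it reduces to probability measures.  The induction below produces measures of arbitrary mass.\<close>

lemma finite_measure_eqI_mgf:
  fixes M N :: "real measure"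
  assumes sets: "sets M = sets borel" "sets N = sets borel"
    and fin: "\<And>s. (\<integral>\<^sup>+u. ennreal (exp (s * u)) \<partial>M) < \<infinity>"
    and eq: "\<And>s. (\<integral>\<^sup>+u. ennreal (exp (s * u)) \<partial>M) = (\<integral>\<^sup>+u. ennreal (exp (s * u)) \<partial>N)"
  shows "M = N"
proof -
  have spaces: "space M = UNIV" "space N = UNIV"
    using sets_eq_imp_space_eq[OF sets(1)] sets_eq_imp_space_eq[OF sets(2)] by simp_all
  define c where "c = emeasure M UNIV"
  have cN: "c = emeasure N UNIV" using eq[of 0] spaces by (simp add: c_def)
  have c_fin: "c < \<infinity>" using fin[of 0] spaces by (simp add: c_def)
  show ?thesis
  proof (cases "c = 0")
    case True
    show ?thesis
    proof (rule measure_eqI)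
      show "sets M = sets N" using sets by simp
      fix A
      have "emeasure M A \<le> emeasure M (space M)" "emeasure N A \<le> emeasure N (space N)"
        by (rule emeasure_space)+
      then show "emeasure M A = emeasure N A" using True cN spaces by (simp add: c_def)
    qed
  next
    case False
    let ?n = "\<lambda>K. scale_measure (1 / c) K"
    have inv: "1 / c * c = 1" using False c_fin
      by (simp add: ennreal_divide_times ennreal_divide_self)
    have inv': "c * (1 / c) = 1" using inv by (simp add: mult.commute)
    have rd: "real_distribution (?n K)" if "sets K = sets borel" "emeasure K UNIV = c" for K :: "real measure"
    proof -
      have "space K = UNIV" using sets_eq_imp_space_eq[OF that(1)] by simp
      then have "prob_space (?n K)"
        by (intro prob_spaceI) (simp add: space_scale_measure that inv)
      then show ?thesis using that(1)
        by (auto simp: real_distribution_def real_distribution_axioms_def space_scale_measure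
            sets_eq_imp_space_eq)
    qed
    have "?n M = ?n N"
    proof (rule prob_eqI_mgf)
      show "real_distribution (?n M)" "real_distribution (?n N)"
        using sets by (intro rd; simp add: cN[symmetric] c_def)+
      have meas: "(\<lambda>u. ennreal (exp (s * u))) \<in> borel_measurable M" for s
        using sets by (simp cong: measurable_cong_sets)
      have meas': "(\<lambda>u. ennreal (exp (s * u))) \<in> borel_measurable N" for s
        using sets by (simp cong: measurable_cong_sets)
      have "1 / c \<noteq> \<top>" using False by (simp add: ennreal_divide_eq_top_iff)
      then have "1 / c < \<infinity>" by (simp add: less_top)
      then show "(\<integral>\<^sup>+ u. ennreal (exp (s * u)) \<partial>?n M) < \<infinity>" for s
        using fin[of s] by (simp add: nn_integral_scale_measure[OF meas] ennreal_mult_less_top)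
      show "(\<integral>\<^sup>+ u. ennreal (exp (s * u)) \<partial>?n M) = (\<integral>\<^sup>+ u. ennreal (exp (s * u)) \<partial>?n N)" for s
        using eq[of s] by (simp add: nn_integral_scale_measure[OF meas] nn_integral_scale_measure[OF meas'])
    qed
    show ?thesis
    proof (rule measure_eqI)
      show "sets M = sets N" using sets by simp
      fix A
      have "1 / c * emeasure M A = 1 / c * emeasure N A"
        using arg_cong[OF \<open>?n M = ?n N\<close>, of "\<lambda>K. emeasure K A"] by simp
      then have "c * (1 / c * emeasure M A) = c * (1 / c * emeasure N A)" by simp
      then show "emeasure M A = emeasure N A" by (simp only: mult.assoc[symmetric] inv' mult_1)
    qed
  qed
qed

text \<open>The exponential factors \<open>exp (t i * v i)\<close> are replaced by indicators \<open>v i \<in> A i\<close> one coordinate at a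
  time.  For coordinate \<open>j\<close>, all other factors are nonnegative and serve as a density \<open>W\<close>; the images of
  the two weighted measures under \<open>v \<mapsto> v j\<close> have equal moment generating functions, so they are equal and
  agree on \<open>A j\<close>.  When all coordinates are treated, the measures agree on boxes.\<close>

lemma PiM_measure_eqI_mgf:
  fixes M N :: "('i \<Rightarrow> real) measure"
  assumes I: "finite I" and sets[measurable_cong]: "sets M = sets (\<Pi>\<^sub>M i\<in>I. borel)" "sets N = sets (\<Pi>\<^sub>M i\<in>I. borel)"
    and fin: "\<And>t. (\<integral>\<^sup>+v. ennreal (exp (\<Sum>i\<in>I. t i * v i)) \<partial>M) < \<infinity>"
    and eq: "\<And>t. (\<integral>\<^sup>+v. ennreal (exp (\<Sum>i\<in>I. t i * v i)) \<partial>M)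
                 = (\<integral>\<^sup>+v. ennreal (exp (\<Sum>i\<in>I. t i * v i)) \<partial>N)"
  shows "M = N"
proof -
  let ?w = "\<lambda>A J t v. ennreal (exp (\<Sum>i\<in>I - J. t i * v i)) * (\<Prod>i\<in>J. indicator (A i) (v i))"
  have mixed: "(\<integral>\<^sup>+v. ?w A J t v \<partial>M) = (\<integral>\<^sup>+v. ?w A J t v \<partial>N)"
    if A: "\<And>i. A i \<in> sets borel" and J: "J \<subseteq> I" for A J t
    using finite_subset[OF J I] J
  proof (induction J arbitrary: t rule: finite_induct)
    case empty
    then show ?case using eq by simp
  next
    case (insert j J)
    have jI: "j \<in> I" and JI: "J \<subseteq> I" and fJ: "finite J" and jJ: "j \<notin> J" using insert by auto
    note [measurable] = A
    let ?K = "insert j J"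
    \<comment> \<open>Setting \<open>t j\<close> to \<open>0\<close> removes the factor of coordinate \<open>j\<close> from the weight.\<close>
    define W where "W v = ?w A J (t(j := 0)) v" for v
    have split: "(\<Sum>i\<in>I - J. (t(j := r)) i * v i) = r * v j + (\<Sum>i\<in>I - ?K. t i * v i)" for r v
    proof -
      have "(\<Sum>i\<in>I - J. (t(j := r)) i * v i) = (t(j := r)) j * v j + (\<Sum>i\<in>I - J - {j}. (t(j := r)) i * v i)"
        by (rule sum.remove) (use I jI jJ in auto)
      also have "(\<Sum>i\<in>I - J - {j}. (t(j := r)) i * v i) = (\<Sum>i\<in>I - ?K. t i * v i)"
        by (rule sum.cong) auto
      finally show ?thesis by simp
    qed
    have W_exp: "?w A J (t(j := s)) v = W v * ennreal (exp (s * v j))" for s v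
      unfolding W_def split by (simp add: exp_add ennreal_mult ac_simps)
    have W_ind: "?w A ?K t v = W v * indicator (A j) (v j)" for v
      unfolding W_def split using fJ jJ by (simp add: ac_simps)
    have comp[measurable]: "(\<lambda>v. v i) \<in> borel_measurable (\<Pi>\<^sub>M i\<in>I. (borel :: real measure))" if "i \<in> I" for i
      using that by (rule measurable_component_singleton)
    have prod[measurable]: "(\<lambda>v. \<Prod>i\<in>J. indicator (A i) (v i) :: ennreal) \<in> borel_measurable (\<Pi>\<^sub>M i\<in>I. (borel :: real measure))"
      using JI by (intro borel_measurable_prod_ennreal measurable_compose[OF comp]) auto
    have Wm: "W \<in> borel_measurable (\<Pi>\<^sub>M i\<in>I. (borel :: real measure))"
      unfolding W_def by (intro borel_measurable_times_ennreal prod measurable_compose[OF _ measurable_ennreal]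
        borel_measurable_exp borel_measurable_sum borel_measurable_times borel_measurable_const comp) auto
    then have [measurable]: "W \<in> borel_measurable M" "W \<in> borel_measurable N"
      using sets by (simp_all cong: measurable_cong_sets)
    have [measurable]: "(\<lambda>v. v j) \<in> borel_measurable M" "(\<lambda>v. v j) \<in> borel_measurable N"
      using comp[OF jI] sets by (simp_all cong: measurable_cong_sets)
    let ?law = "\<lambda>K. distr (density K W) borel (\<lambda>v. v j)"
    have law: "(\<integral>\<^sup>+u. \<phi> u \<partial>?law K) = (\<integral>\<^sup>+v. W v * \<phi> (v j) \<partial>K)"
      if [measurable]: "\<phi> \<in> borel_measurable borel" and "K = M \<or> K = N" for \<phi> K
    proof -
      have [measurable]: "W \<in> borel_measurable K" "(\<lambda>v. v j) \<in> borel_measurable K"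
        using that(2) by auto
      show ?thesis by (subst nn_integral_distr, simp_all add: nn_integral_density)
    qed
    have "?law M = ?law N"
    proof (rule finite_measure_eqI_mgf)
      fix s
      have "(\<integral>\<^sup>+u. ennreal (exp (s * u)) \<partial>?law M) = (\<integral>\<^sup>+v. ?w A J (t(j := s)) v \<partial>M)"
        by (subst law) (simp_all only: W_exp measurable_ennreal, measurable)
      also have "\<dots> = (\<integral>\<^sup>+v. ?w A J (t(j := s)) v \<partial>N)" using insert.IH JI by blast
      also have "\<dots> = (\<integral>\<^sup>+u. ennreal (exp (s * u)) \<partial>?law N)"
        by (subst law) (simp_all only: W_exp measurable_ennreal, measurable)
      finally show "(\<integral>\<^sup>+u. ennreal (exp (s * u)) \<partial>?law M) = (\<integral>\<^sup>+u. ennreal (exp (s * u)) \<partial>?law N)" .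
      have "(\<integral>\<^sup>+u. ennreal (exp (s * u)) \<partial>?law M) = (\<integral>\<^sup>+v. ?w A J (t(j := s)) v \<partial>M)"
        by (subst law) (simp_all only: W_exp measurable_ennreal, measurable)
      \<comment> \<open>Indicators are at most \<open>1\<close>, which is the exponential factor for parameter \<open>0\<close>.\<close>
      also have "\<dots> \<le> (\<integral>\<^sup>+v. ennreal (exp (\<Sum>i\<in>I. (if i \<in> J then 0 else (t(j := s)) i) * v i)) \<partial>M)"
      proof (rule nn_integral_mono)
        fix v
        have "(\<Sum>i\<in>I - J. (t(j := s)) i * v i) = (\<Sum>i\<in>I. (if i \<in> J then 0 else (t(j := s)) i) * v i)"
          by (rule sum.mono_neutral_cong_left) (use I in auto)
        moreover have "(\<Prod>i\<in>J. indicator (A i) (v i) :: ennreal) \<le> 1"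
          by (rule prod_le_1) (auto split: split_indicator)
        ultimately show "?w A J (t(j := s)) v
            \<le> ennreal (exp (\<Sum>i\<in>I. (if i \<in> J then 0 else (t(j := s)) i) * v i))"
          using mult_left_mono[of "\<Prod>i\<in>J. indicator (A i) (v i)" 1] by fastforce
      qed
      also have "\<dots> < \<infinity>" by (rule fin)
      finally show "(\<integral>\<^sup>+u. ennreal (exp (s * u)) \<partial>?law M) < \<infinity>" .
    qed simp_all
    then have "(\<integral>\<^sup>+u. indicator (A j) u \<partial>?law M) = (\<integral>\<^sup>+u. indicator (A j) u \<partial>?law N)" by simp
    then show ?case unfolding W_ind using A by (subst (asm) (1 2) law) auto
  qed
  show ?thesis
  proof (rule measure_eqI_PiM_finite[OF I sets])
    fix A :: "'i \<Rightarrow> real set"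
    assume A: "\<And>i. i \<in> I \<Longrightarrow> A i \<in> sets borel"
    have ind: "(\<Prod>i\<in>I. indicator (if i \<in> I then A i else {}) (v i)) = (indicator (Pi\<^sub>E I A) v :: ennreal)"
      if v: "v \<in> space (\<Pi>\<^sub>M i\<in>I. (borel :: real measure))" for v
    proof (cases "v \<in> Pi\<^sub>E I A")
      case True
      then show ?thesis by (auto simp: PiE_iff intro!: prod.neutral)
    next
      case False
      then obtain i where "i \<in> I" "v i \<notin> A i" using v by (auto simp: space_PiM PiE_iff)
      then have "(indicator (if i \<in> I then A i else {}) (v i) :: ennreal) = 0" by simp
      then have "(\<Prod>i\<in>I. indicator (if i \<in> I then A i else {}) (v i)) = (0 :: ennreal)"
        using I \<open>i \<in> I\<close> by (intro prod_zero bexI)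
      then show ?thesis using False by simp
    qed
    have emeas: "(\<integral>\<^sup>+v. ?w (\<lambda>i. if i \<in> I then A i else {}) I (\<lambda>_. 0) v \<partial>K) = emeasure K (Pi\<^sub>E I A)"
      if K: "sets K = sets (\<Pi>\<^sub>M i\<in>I. (borel :: real measure))" for K
    proof -
      have "(\<integral>\<^sup>+v. ?w (\<lambda>i. if i \<in> I then A i else {}) I (\<lambda>_. 0) v \<partial>K) = (\<integral>\<^sup>+v. indicator (Pi\<^sub>E I A) v \<partial>K)"
        by (rule nn_integral_cong) (use ind sets_eq_imp_space_eq[OF K] in simp)
      also have "\<dots> = emeasure K (Pi\<^sub>E I A)"
        using A by (intro nn_integral_indicator) (simp add: K sets_PiM_I_finite I)
      finally show ?thesis .
    qed
    show "emeasure M (Pi\<^sub>E I A) = emeasure N (Pi\<^sub>E I A)"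
      using mixed[of "\<lambda>i. if i \<in> I then A i else {}" I "\<lambda>_. 0"] A by (simp only: emeas sets) auto
  next
    have "emeasure M (space M) < \<infinity>" using fin[of "\<lambda>_. 0"] by simp
    moreover have "space M = (\<Pi>\<^sub>E i\<in>I. UNIV)" using sets_eq_imp_space_eq[OF sets(1)] by (simp add: space_PiM)
    ultimately show "range (\<lambda>_ :: nat. \<Pi>\<^sub>E i\<in>I. UNIV) \<subseteq> prod_algebra I (\<lambda>_. borel)"
      "(\<Union>n::nat. \<Pi>\<^sub>E i\<in>I. UNIV) = space (\<Pi>\<^sub>M i\<in>I. (borel :: real measure))"
      "\<And>n::nat. emeasure M (\<Pi>\<^sub>E i\<in>I. UNIV) \<noteq> \<infinity>"
      using I by (auto simp: space_PiM intro!: prod_algebraI_finite[where E="\<lambda>_. UNIV"])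
  qed
qed

section \<open>Positive definite matrices\<close>

lemma det_pos_def_mat:
  assumes "pos_def_mat N A"
  shows "Determinant.det A \<noteq> 0"
proof
  assume "Determinant.det A = 0"
  then obtain v where v: "v \<in> carrier_vec N" "v \<noteq> 0\<^sub>v N" "A *\<^sub>v v = 0\<^sub>v N"
    using det_0_iff_vec_prod_zero_field assms unfolding pos_def_mat_def by blast
  then show False using assms unfolding pos_def_mat_def by force
qed

lemma inv_mat:
  assumes A: "A \<in> carrier_mat N N" and det: "Determinant.det A \<noteq> 0"
  shows "inv_mat A \<in> carrier_mat N N" "A * inv_mat A = 1\<^sub>m N" "inv_mat A * A = 1\<^sub>m N"
proof -
  obtain B where "mat_inverse A = Some B"
    using mat_inverse(1)[OF A, where b = "()"] det_non_zero_imp_unit[OF A det, of "()"] by blast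
  then show "inv_mat A \<in> carrier_mat N N" "A * inv_mat A = 1\<^sub>m N" "inv_mat A * A = 1\<^sub>m N"
    using mat_inverse(2)[OF A] by (auto simp: inv_mat_def)
qed

text \<open>Cramer's rule writes the entries of the inverse as rational functions of those of the matrix, which
  is how \<^const>\<open>inv_mat\<close> will be seen to be measurable.\<close>

lemma inv_mat_adj_mat:
  assumes A: "A \<in> carrier_mat N N" and det: "Determinant.det A \<noteq> 0"
  shows "inv_mat A = (1 / Determinant.det A) \<cdot>\<^sub>m adj_mat A"
proof -
  let ?B = "(1 / Determinant.det A) \<cdot>\<^sub>m adj_mat A"
  note adj = adj_mat[OF A] and inv = inv_mat[OF A det]
  have B: "?B \<in> carrier_mat N N" using adj by simp
  have AB: "A * ?B = 1\<^sub>m N" using adj A det by (auto simp: mult_smult_distrib intro!: eq_matI)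
  have "inv_mat A = inv_mat A * (A * ?B)" using inv(1) AB by simp
  also have "\<dots> = inv_mat A * A * ?B" by (rule assoc_mult_mat[OF inv(1) A B, symmetric])
  also have "\<dots> = ?B" by (simp only: inv(3) left_mult_one_mat[OF B])
  finally show ?thesis .
qed

lemma pos_def_mat_inv:
  assumes C: "pos_def_mat N C" and u: "u \<in> carrier_vec N"
  shows "inv_mat C *\<^sub>v u \<in> carrier_vec N"
    and "C *\<^sub>v (inv_mat C *\<^sub>v u) = u"
    and "inv_mat C *\<^sub>v (C *\<^sub>v u) = u"
proof -
  have c: "C \<in> carrier_mat N N" using C by (simp add: pos_def_mat_def)
  note inv = inv_mat[OF c det_pos_def_mat[OF C]]
  show "inv_mat C *\<^sub>v u \<in> carrier_vec N" using inv u by simp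
  show "C *\<^sub>v (inv_mat C *\<^sub>v u) = u" "inv_mat C *\<^sub>v (C *\<^sub>v u) = u"
    using inv u c by (simp_all flip: assoc_mult_mat_vec)
qed

lemma pos_def_mat_sym:
  assumes C: "pos_def_mat N C" and u: "u \<in> carrier_vec N" and v: "v \<in> carrier_vec N"
  shows "u \<bullet> (C *\<^sub>v v) = v \<bullet> (C *\<^sub>v u)"
    and "u \<bullet> (inv_mat C *\<^sub>v v) = v \<bullet> (inv_mat C *\<^sub>v u)"
proof -
  have c: "C \<in> carrier_mat N N" and t: "transpose_mat C = C" using C by (simp_all add: pos_def_mat_def)
  have sym: "u \<bullet> (C *\<^sub>v v) = v \<bullet> (C *\<^sub>v u)" if "u \<in> carrier_vec N" "v \<in> carrier_vec N" for u v
    using transpose_vec_mult_scalar[OF c that(2,1)] that c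
    by (simp add: t comm_scalar_prod[of _ N])
  show "u \<bullet> (C *\<^sub>v v) = v \<bullet> (C *\<^sub>v u)" using u v by (rule sym)
  show "u \<bullet> (inv_mat C *\<^sub>v v) = v \<bullet> (inv_mat C *\<^sub>v u)"
    using sym[of "inv_mat C *\<^sub>v v" "inv_mat C *\<^sub>v u"] pos_def_mat_inv[OF C] u v
    by (simp add: comm_scalar_prod[of _ N])
qed

text \<open>Negated and halved, this is the exponent of a normal density with covariance \<open>C\<close> multiplied by
  \<open>exp (t \<bullet> v)\<close>, up to a constant: that product is a multiple of the density translated by \<open>C *\<^sub>v t\<close>.\<close>

lemma complete_the_square:
  assumes C: "pos_def_mat N C" and t: "t \<in> carrier_vec N" and v: "v \<in> carrier_vec N"
  shows "(v - C *\<^sub>v t) \<bullet> (inv_mat C *\<^sub>v (v - C *\<^sub>v t))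
       = v \<bullet> (inv_mat C *\<^sub>v v) - 2 * (t \<bullet> v) + t \<bullet> (C *\<^sub>v t)"
proof -
  have c: "C \<in> carrier_mat N N" using C by (simp add: pos_def_mat_def)
  note inv = inv_mat[OF c det_pos_def_mat[OF C]]
  have Ct: "C *\<^sub>v t \<in> carrier_vec N" using c t by simp
  have "inv_mat C *\<^sub>v (v - C *\<^sub>v t) = inv_mat C *\<^sub>v v - t"
    using mult_minus_distrib_mat_vec[OF inv(1) v Ct] pos_def_mat_inv(3)[OF C t] by simp
  moreover have "(C *\<^sub>v t) \<bullet> (inv_mat C *\<^sub>v v) = t \<bullet> v"
    using pos_def_mat_sym(2)[OF C Ct v] pos_def_mat_inv(3)[OF C t] t v by (simp add: comm_scalar_prod[of _ N])
  ultimately show ?thesis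
    using v t Ct pos_def_mat_inv(1)[OF C v]
    by (simp add: minus_scalar_prod_distrib[of _ N] scalar_prod_minus_distrib[of _ N] comm_scalar_prod[of v N t]
        comm_scalar_prod[of "C *\<^sub>v t" N t])
qed

text \<open>With \<open>C\<close> the covariance of the data and \<open>u\<close> their covariance with a further variable, the right hand
  side is the joint quadratic form of data and variable, except that the variance of the variable is
  replaced by the part of it that the data explain.\<close>

lemma quadratic_form_shift:
  assumes C: "pos_def_mat N C" and b: "b \<in> carrier_vec N" and u: "u \<in> carrier_vec N"
  shows "(b + a \<cdot>\<^sub>v (inv_mat C *\<^sub>v u)) \<bullet> (C *\<^sub>v (b + a \<cdot>\<^sub>v (inv_mat C *\<^sub>v u)))
       = b \<bullet> (C *\<^sub>v b) + 2 * a * (b \<bullet> u) + a\<^sup>2 * (u \<bullet> (inv_mat C *\<^sub>v u))"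
proof -
  have c: "C \<in> carrier_mat N N" using C by (simp add: pos_def_mat_def)
  have Cb: "C *\<^sub>v b \<in> carrier_vec N" using c b by simp
  define p where "p = inv_mat C *\<^sub>v u"
  have p: "p \<in> carrier_vec N" "C *\<^sub>v p = u" using pos_def_mat_inv[OF C u] by (simp_all add: p_def)
  have "C *\<^sub>v (b + a \<cdot>\<^sub>v p) = C *\<^sub>v b + a \<cdot>\<^sub>v u"
    using mult_add_distrib_mat_vec[OF c b, of "a \<cdot>\<^sub>v p"] mult_mat_vec[OF c p(1)] p by simp
  moreover have "p \<bullet> (C *\<^sub>v b) = b \<bullet> u" using pos_def_mat_sym(1)[OF C p(1) b] p by simp
  ultimately show ?thesis
    using b u Cb p unfolding p_def[symmetric]
    by (simp add: add_scalar_prod_distrib[of _ N] scalar_prod_add_distrib[of _ N] power2_eq_square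
        comm_scalar_prod[of p N u] algebra_simps)
qed

lemma scalar_prod_vec: "Matrix.vec N a \<bullet> Matrix.vec N b = (\<Sum>i<N. a i * b i)"
  by (simp add: scalar_prod_def lessThan_atLeast0)

lemma quadratic_form_sum:
  assumes "(C :: real mat) \<in> carrier_mat N N"
  shows "Matrix.vec N a \<bullet> (C *\<^sub>v Matrix.vec N b) = (\<Sum>i<N. \<Sum>j<N. a i * b j * C $$ (i, j))"
proof -
  have "C *\<^sub>v Matrix.vec N b = Matrix.vec N (\<lambda>i. \<Sum>j<N. C $$ (i, j) * b j)"
    using assms by (intro eq_vecI) (auto simp: scalar_prod_def lessThan_atLeast0)
  then show ?thesis
    by (auto simp: scalar_prod_vec sum_distrib_left intro!: sum.cong)
qed

lemma measurable_det:
  assumes "\<And>i j. i < n \<Longrightarrow> j < n \<Longrightarrow> (\<lambda>\<omega>. a \<omega> i j) \<in> borel_measurable M"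
  shows "(\<lambda>\<omega>. Determinant.det (Matrix.mat n n (\<lambda>(i, j). a \<omega> i j)) :: real) \<in> borel_measurable M"
proof -
  have "Determinant.det (Matrix.mat n n (\<lambda>(i, j). a \<omega> i j))
      = (\<Sum>p | p permutes {0..<n}. signof p * (\<Prod>i = 0..<n. a \<omega> i (p i)))" for \<omega>
    by (subst det_def'[of _ n]) (auto simp: permutes_in_image intro!: sum.cong prod.cong)
  moreover have "(\<lambda>\<omega>. \<Sum>p | p permutes {0..<n}. signof p * (\<Prod>i = 0..<n. a \<omega> i (p i))) \<in> borel_measurable M"
    by (intro borel_measurable_sum borel_measurable_times borel_measurable_prod borel_measurable_const assms)
       (auto simp: permutes_in_image)
  ultimately show ?thesis by simp
qed

lemma measurable_inv_mat:
  fixes A :: "'b \<Rightarrow> real mat"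
  assumes carrier: "\<And>\<omega>. A \<omega> \<in> carrier_mat n n" and det: "\<And>\<omega>. Determinant.det (A \<omega>) \<noteq> 0"
    and meas: "\<And>i j. i < n \<Longrightarrow> j < n \<Longrightarrow> (\<lambda>\<omega>. A \<omega> $$ (i, j)) \<in> borel_measurable M"
    and ij: "i < n" "j < n"
  shows "(\<lambda>\<omega>. inv_mat (A \<omega>) $$ (i, j)) \<in> borel_measurable M"
proof -
  have A: "A \<omega> = Matrix.mat n n (\<lambda>(i, j). A \<omega> $$ (i, j))" for \<omega>
    using carrier[of \<omega>] by (intro eq_matI) auto
  have dims: "dim_row (A \<omega>) = n" "dim_col (A \<omega>) = n" for \<omega> using carrier[of \<omega>] by auto
  have "inv_mat (A \<omega>) $$ (i, j) = 1 / Determinant.det (A \<omega>) * cofactor (A \<omega>) j i" for \<omega>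
    using inv_mat_adj_mat[OF carrier det, of \<omega>] ij dims by (simp add: adj_mat_def)
  moreover have "(\<lambda>\<omega>. Determinant.det (A \<omega>)) \<in> borel_measurable M"
    by (subst A) (intro measurable_det meas)
  moreover have "(\<lambda>\<omega>. cofactor (A \<omega>) j i) \<in> borel_measurable M"
    unfolding cofactor_def mat_delete_def dims
    by (intro borel_measurable_times borel_measurable_const measurable_det meas) auto
  ultimately show ?thesis by simp
qed

section \<open>Moment generating functions of normal vectors and Gaussian processes\<close>

lemma PiM_lborel_translate:
  assumes I: "finite I"
  shows "distr (\<Pi>\<^sub>M i\<in>I. lborel) (\<Pi>\<^sub>M i\<in>I. lborel) (\<lambda>v. \<lambda>i\<in>I. v i + c i) = (\<Pi>\<^sub>M i\<in>I. lborel :: real measure)"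
proof -
  interpret product_sigma_finite "\<lambda>_. lborel :: real measure" by standard
  have m[measurable]: "(\<lambda>v. \<lambda>i\<in>I. v i + c i) \<in> measurable (\<Pi>\<^sub>M i\<in>I. lborel) (\<Pi>\<^sub>M i\<in>I. lborel :: real measure)"
    by measurable
  show ?thesis
  proof (rule PiM_eqI[OF I])
    fix A :: "'a \<Rightarrow> real set" assume A: "\<And>i. i \<in> I \<Longrightarrow> A i \<in> sets lborel"
    have tr: "(\<lambda>u. u + c i) -` A i \<in> sets lborel" "emeasure lborel ((\<lambda>u. u + c i) -` A i) = emeasure lborel (A i)"
      if "i \<in> I" for i
    proof -
      have meas: "(\<lambda>u. u + c i) \<in> measurable lborel borel" by simp
      show "(\<lambda>u. u + c i) -` A i \<in> sets lborel" using measurable_sets[OF meas, of "A i"] A[OF that] by simp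
      have "distr lborel borel (\<lambda>u. u + c i) = lborel"
        using lborel_distr_plus[of "c i"] by (simp add: add.commute[of _ "c i"])
      then show "emeasure lborel ((\<lambda>u. u + c i) -` A i) = emeasure lborel (A i)"
        using emeasure_distr[OF meas, of "A i"] A[OF that] by simp
    qed
    have "(\<lambda>v. \<lambda>i\<in>I. v i + c i) -` Pi\<^sub>E I A \<inter> space (\<Pi>\<^sub>M i\<in>I. lborel) = Pi\<^sub>E I (\<lambda>i. (\<lambda>u. u + c i) -` A i)"
      by (auto simp: space_PiM PiE_iff)
    then have "emeasure (distr (\<Pi>\<^sub>M i\<in>I. lborel) (\<Pi>\<^sub>M i\<in>I. lborel) (\<lambda>v. \<lambda>i\<in>I. v i + c i)) (Pi\<^sub>E I A)
        = emeasure (\<Pi>\<^sub>M i\<in>I. lborel) (Pi\<^sub>E I (\<lambda>i. (\<lambda>u. u + c i) -` A i))"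
      using A I by (subst emeasure_distr) (auto intro!: sets_PiM_I_finite)
    also have "\<dots> = (\<Prod>i\<in>I. emeasure lborel ((\<lambda>u. u + c i) -` A i))"
      using tr(1) by (intro emeasure_PiM I) auto
    finally show "emeasure (distr (\<Pi>\<^sub>M i\<in>I. lborel) (\<Pi>\<^sub>M i\<in>I. lborel) (\<lambda>v. \<lambda>i\<in>I. v i + c i)) (Pi\<^sub>E I A)
        = (\<Prod>i\<in>I. emeasure lborel (A i))"
      using tr(2) by simp
  qed simp
qed

text \<open>Completing the square turns \<open>exp (t \<bullet> v)\<close> times the density into a constant times a translate of the
  density.  Translation does not change its integral, which is \<open>1\<close> because it is the density of \<open>Z\<close>; thus
  the normalizing constant of the density never has to be computed.\<close>

lemma multivariate_normal_mgf:
  assumes "prob_space M" and C: "pos_def_mat N C" and Z: "multivariate_normal M N Z C"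
  shows "(\<integral>\<^sup>+\<omega>. ennreal (exp (\<Sum>i<N. t i * Z \<omega> i)) \<partial>M)
       = ennreal (exp ((\<Sum>i<N. \<Sum>j<N. t i * t j * C $$ (i, j)) / 2))"
proof -
  interpret prob_space M by fact
  let ?L = "\<Pi>\<^sub>M i\<in>{..<N}. lborel :: real measure"
  let ?d = "\<lambda>v. ennreal (mvn_density N C v)"
  let ?q = "\<Sum>i<N. \<Sum>j<N. t i * t j * C $$ (i, j)"
  have c: "C \<in> carrier_mat N N" using C by (simp add: pos_def_mat_def)
  have dist: "distributed M ?L Z ?d" using Z by (simp add: multivariate_normal_def)
  have d_meas[measurable]: "?d \<in> borel_measurable ?L" by (rule distributed_borel_measurable[OF dist])
  define shift where "shift v = (\<lambda>i\<in>{..<N}. v i + - ((C *\<^sub>v Matrix.vec N t) $ i))" for v :: "nat \<Rightarrow> real"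
  have shift_meas[measurable]: "shift \<in> measurable ?L ?L" unfolding shift_def by measurable
  have exp_meas[measurable]: "(\<lambda>v. ennreal (exp (\<Sum>i<N. t i * v i))) \<in> borel_measurable ?L" by measurable
  have exponents: "exp (- e / 2) * exp s = exp (q / 2) * exp (- (e - 2 * s + q) / 2)" for e s q :: real
    unfolding mult_exp_exp by (rule arg_cong[where f = exp]) (simp add: field_simps)
  have key: "?d v * ennreal (exp (\<Sum>i<N. t i * v i)) = ennreal (exp (?q / 2)) * ?d (shift v)" for v
  proof -
    have "Matrix.vec N (shift v) = Matrix.vec N v - C *\<^sub>v Matrix.vec N t"
      using c by (intro eq_vecI) (auto simp: shift_def)
    then have sq: "mvn_density N C (shift v) = exp (- (Matrix.vec N v \<bullet> (inv_mat C *\<^sub>v Matrix.vec N v)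
        - 2 * (\<Sum>i<N. t i * v i) + ?q) / 2) / sqrt ((2 * pi) ^ N * Determinant.det C)"
      using complete_the_square[OF C, of "Matrix.vec N t" "Matrix.vec N v"]
      by (simp add: mvn_density_def scalar_prod_vec quadratic_form_sum[OF c])
    have "mvn_density N C v * exp (\<Sum>i<N. t i * v i) = exp (?q / 2) * mvn_density N C (shift v)"
      unfolding sq by (simp only: mvn_density_def times_divide_eq_left times_divide_eq_right exponents[of _ _ ?q])
    then have "ennreal (mvn_density N C v * exp (\<Sum>i<N. t i * v i))
        = ennreal (exp (?q / 2) * mvn_density N C (shift v))" by (rule arg_cong)
    then show ?thesis by (simp only: ennreal_mult'[OF exp_ge_zero] ennreal_mult''[OF exp_ge_zero])
  qed
  have mass: "(\<integral>\<^sup>+v. ?d v \<partial>?L) = 1"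
    using distributed_nn_integral[OF dist, of "\<lambda>_. 1"] by (simp add: emeasure_space_1)
  have "(\<integral>\<^sup>+\<omega>. ennreal (exp (\<Sum>i<N. t i * Z \<omega> i)) \<partial>M) = (\<integral>\<^sup>+v. ?d v * ennreal (exp (\<Sum>i<N. t i * v i)) \<partial>?L)"
    by (rule distributed_nn_integral[OF dist exp_meas, symmetric])
  also have "\<dots> = ennreal (exp (?q / 2)) * (\<integral>\<^sup>+v. ?d (shift v) \<partial>?L)"
    unfolding key by (rule nn_integral_cmult) measurable
  also have "(\<integral>\<^sup>+v. ?d (shift v) \<partial>?L) = (\<integral>\<^sup>+v. ?d v \<partial>distr ?L ?L shift)"
    by (rule nn_integral_distr[symmetric]) measurable
  also have "distr ?L ?L shift = ?L"
    unfolding shift_def by (rule PiM_lborel_translate) simp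
  finally show ?thesis using mass by simp
qed

text \<open>The finite-dimensional laws of a Gaussian process are prescribed at distinct points only.  A linear
  combination over points with repetitions is one over distinct points, with the coefficients of equal
  points added.  This covers the case that the test input is one of the training inputs.\<close>

lemma sum_group_points:
  fixes a :: "nat \<Rightarrow> real" and p :: "nat \<Rightarrow> 'a"
  obtains N :: nat and q :: "nat \<Rightarrow> 'a" and c :: "nat \<Rightarrow> real"  where "inj_on q {..<N}" "q ` {..<N} = p ` {..<n}"
    "\<And>\<phi> :: 'a \<Rightarrow> real. (\<Sum>i<n. a i * \<phi> (p i)) = (\<Sum>m<N. c m * \<phi> (q m))"
proof -
  let ?P = "p ` {..<n}"
  obtain q where q: "bij_betw q {0..<card ?P} ?P" using ex_bij_betw_nat_finite[of ?P] by auto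
  define c where "c z = (\<Sum>i | i \<in> {..<n} \<and> p i = z. a i)" for z
  show thesis
  proof (rule that)
    show "inj_on q {..<card ?P}" "q ` {..<card ?P} = ?P"
      using q by (auto simp: bij_betw_def lessThan_atLeast0)
    fix \<phi> :: "'a \<Rightarrow> real"
    have "(\<Sum>i<n. a i * \<phi> (p i)) = (\<Sum>z\<in>?P. \<Sum>i | i \<in> {..<n} \<and> p i = z. a i * \<phi> (p i))"
      by (rule sum.group[symmetric]) auto
    also have "\<dots> = (\<Sum>z\<in>?P. c z * \<phi> z)"
      unfolding c_def sum_distrib_right by (intro sum.cong) auto
    also have "\<dots> = (\<Sum>m<card ?P. c (q m) * \<phi> (q m))"
      using q unfolding lessThan_atLeast0 by (intro sum.reindex_bij_betw[symmetric])
    finally show "(\<Sum>i<n. a i * \<phi> (p i)) = (\<Sum>m<card ?P. c (q m) * \<phi> (q m))" .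
  qed
qed

lemma kernel_form_group_points:
  fixes k :: "'a \<Rightarrow> 'a \<Rightarrow> real"
  assumes "\<And>\<phi> :: 'a \<Rightarrow> real. (\<Sum>i<n. a i * \<phi> (p i)) = (\<Sum>m<N. c m * \<phi> (q m))"
  shows "(\<Sum>i<n. \<Sum>j<n. a i * a j * k (p i) (p j)) = (\<Sum>i<N. \<Sum>j<N. c i * c j * k (q i) (q j))"
proof -
  have "(\<Sum>i<n. \<Sum>j<n. a i * a j * k (p i) (p j)) = (\<Sum>i<n. a i * (\<Sum>j<n. a j * k (p i) (p j)))"
    by (simp add: sum_distrib_left mult.assoc)
  also have "\<dots> = (\<Sum>i<n. a i * (\<Sum>j<N. c j * k (p i) (q j)))" by (simp only: assms)
  also have "\<dots> = (\<Sum>i<N. c i * (\<Sum>j<N. c j * k (q i) (q j)))" by (rule assms)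
  finally show ?thesis by (simp add: sum_distrib_left mult.assoc)
qed

lemma gaussian_process_mgf:
  fixes a :: "nat \<Rightarrow> real" and p :: "nat \<Rightarrow> 'a"
  assumes "prob_space M" and F: "gaussian_process M X k F" and p: "p ` {..<n} \<subseteq> X"
  shows "(\<integral>\<^sup>+\<omega>. ennreal (exp (\<Sum>i<n. a i * F (p i) \<omega>)) \<partial>M)
       = ennreal (exp ((\<Sum>i<n. \<Sum>j<n. a i * a j * k (p i) (p j)) / 2))"
proof -
  obtain N :: nat and q :: "nat \<Rightarrow> 'a" and c :: "nat \<Rightarrow> real" where q: "inj_on q {..<N}" "q ` {..<N} = p ` {..<n}"
    and grp: "\<And>\<phi> :: 'a \<Rightarrow> real. (\<Sum>i<n. a i * \<phi> (p i)) = (\<Sum>m<N. c m * \<phi> (q m))"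
    by (rule sum_group_points[of p n a]) blast
  have "pos_def_mat N (gram_mat k N q)"
    "multivariate_normal M N (\<lambda>\<omega>. \<lambda>i\<in>{..<N}. F (q i) \<omega>) (gram_mat k N q)"
    using F p q by (auto simp: gaussian_process_def strictly_pos_def_kernel_def)
  from multivariate_normal_mgf[OF assms(1) this, of c] show ?thesis
    unfolding kernel_form_group_points[of a p n c q N k, OF grp] by (simp add: grp[of "\<lambda>z. F z _"] gram_mat_def)
qed

lemma kernel_form_nonneg:
  fixes a :: "nat \<Rightarrow> real" and p :: "nat \<Rightarrow> 'a"
  assumes k: "strictly_pos_def_kernel X k" and p: "p ` {..<n} \<subseteq> X"
  shows "(\<Sum>i<n. \<Sum>j<n. a i * a j * k (p i) (p j)) \<ge> 0"
proof -
  obtain N :: nat and q :: "nat \<Rightarrow> 'a" and c :: "nat \<Rightarrow> real" where q: "inj_on q {..<N}" "q ` {..<N} = p ` {..<n}"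
    and grp: "\<And>\<phi> :: 'a \<Rightarrow> real. (\<Sum>i<n. a i * \<phi> (p i)) = (\<Sum>m<N. c m * \<phi> (q m))"
    by (rule sum_group_points[of p n a]) blast
  have pd: "pos_def_mat N (gram_mat k N q)"
    using k p q by (auto simp: strictly_pos_def_kernel_def)
  then have cm: "gram_mat k N q \<in> carrier_mat N N" by (simp add: pos_def_mat_def)
  have "Matrix.vec N c \<bullet> (gram_mat k N q *\<^sub>v Matrix.vec N c) \<ge> 0"
  proof (cases "Matrix.vec N c = 0\<^sub>v N")
    case True
    then show ?thesis using cm by simp
  next
    case False
    then show ?thesis using pd by (auto simp: pos_def_mat_def intro: less_imp_le)
  qed
  then show ?thesis
    unfolding kernel_form_group_points[of a p n c q N k, OF grp] quadratic_form_sum[OF cm] by (simp add: gram_mat_def)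
qed

abbreviation std_normal :: "real measure" where
  "std_normal \<equiv> density lborel std_normal_density"

lemma prob_space_std_normal: "prob_space std_normal"
  by (rule prob_space_normal_density) simp

lemma std_normal_mgf: "(\<integral>\<^sup>+z. ennreal (exp (s * z)) \<partial>std_normal) = ennreal (exp (s\<^sup>2 / 2))"
proof -
  have "(\<integral>\<^sup>+z. ennreal (exp (s * z)) \<partial>std_normal) = (\<integral>\<^sup>+z. ennreal (std_normal_density z) * ennreal (exp (s * z)) \<partial>lborel)"
    by (rule nn_integral_density) auto
  also have "\<dots> = (\<integral>\<^sup>+z. ennreal (exp (s\<^sup>2 / 2)) * ennreal (normal_density s 1 z) \<partial>lborel)"
  proof (rule nn_integral_cong)
    fix z
    have "std_normal_density z * exp (s * z) = exp (s\<^sup>2 / 2) * normal_density s 1 z"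
      by (simp add: normal_density_def mult_exp_exp power2_diff field_simps)
    then show "ennreal (std_normal_density z) * ennreal (exp (s * z)) = ennreal (exp (s\<^sup>2 / 2)) * ennreal (normal_density s 1 z)"
      by (simp add: ennreal_mult''[symmetric] ennreal_mult'[symmetric])
  qed
  also have "\<dots> = ennreal (exp (s\<^sup>2 / 2)) * emeasure (density lborel (normal_density s 1)) UNIV"
    by (simp add: nn_integral_cmult emeasure_density)
  also have "emeasure (density lborel (normal_density s 1)) UNIV = 1"
    using prob_space.emeasure_space_1[OF prob_space_normal_density[of 1 s]] by simp
  finally show ?thesis by simp
qed

text \<open>The substitution \<open>u = sqrt 2 * t\<close> turns the integrand of \<^const>\<open>erfc\<close> into the normal density.\<close>

lemma erfc_std_normal: "erfc a = 2 * measure std_normal {sqrt 2 * a..}"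
proof -
  have "measure std_normal {sqrt 2 * a..} = (LINT u|lborel. std_normal_density u * indicator {sqrt 2 * a..} u)"
    using integral_real_density[of std_normal_density lborel "indicator {sqrt 2 * a..}"] by simp
  also have "\<dots> = \<bar>sqrt 2\<bar> *\<^sub>R (LINT t|lborel. std_normal_density (0 + sqrt 2 * t) * indicator {sqrt 2 * a..} (0 + sqrt 2 * t))"
    by (rule lborel_integral_real_affine) simp
  also have "\<dots> = sqrt 2 * (LINT t|lborel. 1 / sqrt (2 * pi) * (indicator {a..} t *\<^sub>R exp (- t\<^sup>2)))"
    by (auto simp: std_normal_density_def power_mult_distrib split: split_indicator intro!: Bochner_Integration.integral_cong)
  also have "\<dots> = 1 / sqrt pi * (LBINT t:{a..}. exp (- t\<^sup>2))"
    unfolding set_lebesgue_integral_def by (simp add: real_sqrt_mult)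
  finally show ?thesis by (simp add: erfc_def)
qed

lemma measure_std_normal_atMost: "measure std_normal {..c} = 1 - erfc (c / sqrt 2) / 2"
proof -
  interpret prob_space std_normal by (rule prob_space_std_normal)
  have "emeasure std_normal {c} = 0"
    by (simp add: emeasure_density)
  then have "measure std_normal {c} = 0" by (simp add: measure_def)
  moreover have "measure std_normal {c..} = measure std_normal {c} + measure std_normal {c<..}"
    by (subst finite_measure_Union[symmetric]) (auto intro!: arg_cong[where f = prob])
  moreover have "measure std_normal {..c} = 1 - measure std_normal {c<..}"
    using prob_compl[of "{c<..}"] by (simp add: Compl_eq_Diff_UNIV[symmetric])
  ultimately show ?thesis by (simp add: erfc_std_normal)
qed

lemma erfc_bounds: "0 \<le> erfc a" "erfc a \<le> 2"
  using prob_space.prob_le_1[OF prob_space_std_normal, of "{sqrt 2 * a..}"] by (simp_all add: erfc_std_normal)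

lemma measurable_erfc [measurable]: "erfc \<in> borel_measurable borel"
proof -
  interpret prob_space std_normal by (rule prob_space_std_normal)
  have "mono (\<lambda>a. - erfc a)"
    by (auto simp: mono_def erfc_std_normal intro!: finite_measure_mono)
  then have "(\<lambda>a. - erfc a) \<in> borel_measurable borel" by (rule borel_measurable_mono)
  then show ?thesis by (simp add: borel_measurable_uminus_eq)
qed

lemma (in prob_space) mean_std_normal_mgf:
  fixes D S :: nat
  assumes S: "S \<ge> 1" and normal: "\<And>d s. d < D \<Longrightarrow> s < S \<Longrightarrow> distributed M lborel (Z d s) std_normal_density"
    and indep: "indep_vars (\<lambda>_. borel) (\<lambda>(d, s). Z d s) ({..<D} \<times> {..<S})"
  shows "(\<integral>\<^sup>+\<omega>. ennreal (exp (\<Sum>d<D. c d * ((\<Sum>s<S. Z d s \<omega>) / real S))) \<partial>M)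
       = ennreal (exp ((\<Sum>d<D. (c d)\<^sup>2 / real S) / 2))"
proof -
  let ?I = "{..<D} \<times> {..<S}"
  have "ennreal (exp (\<Sum>d<D. c d * ((\<Sum>s<S. Z d s \<omega>) / real S)))
      = (\<Prod>p\<in>?I. ennreal (exp (c (fst p) / real S * (case p of (d, s) \<Rightarrow> Z d s) \<omega>)))" for \<omega>
  proof -
    have "(\<Sum>d<D. c d * ((\<Sum>s<S. Z d s \<omega>) / real S)) = (\<Sum>d<D. \<Sum>s<S. c d / real S * Z d s \<omega>)"
      by (simp add: sum_distrib_left sum_divide_distrib)
    also have "\<dots> = (\<Sum>p\<in>?I. c (fst p) / real S * (case p of (d, s) \<Rightarrow> Z d s) \<omega>)"
      unfolding sum.cartesian_product by (intro sum.cong) auto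
    finally have eq: "(\<Sum>d<D. c d * ((\<Sum>s<S. Z d s \<omega>) / real S)) = \<dots>" .
    have "finite ?I" by simp
    then show ?thesis unfolding eq by (simp add: exp_sum prod_ennreal)
  qed
  then have "(\<integral>\<^sup>+\<omega>. ennreal (exp (\<Sum>d<D. c d * ((\<Sum>s<S. Z d s \<omega>) / real S))) \<partial>M)
      = (\<integral>\<^sup>+\<omega>. (\<Prod>p\<in>?I. ennreal (exp (c (fst p) / real S * (case p of (d, s) \<Rightarrow> Z d s) \<omega>))) \<partial>M)"
    by simp
  also have "\<dots> = (\<Prod>p\<in>?I. \<integral>\<^sup>+\<omega>. ennreal (exp (c (fst p) / real S * (case p of (d, s) \<Rightarrow> Z d s) \<omega>)) \<partial>M)"
    by (rule indep_vars_nn_integral) (auto intro!: indep_vars_compose2[OF indep])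
  also have "\<dots> = (\<Prod>p\<in>?I. ennreal (exp ((c (fst p) / real S)\<^sup>2 / 2)))"
  proof (rule prod.cong[OF refl])
    fix p assume "p \<in> ?I"
    then obtain d s where p: "p = (d, s)" "d < D" "s < S" by auto
    have "(\<integral>\<^sup>+\<omega>. ennreal (exp (c d / real S * Z d s \<omega>)) \<partial>M)
        = (\<integral>\<^sup>+z. ennreal (std_normal_density z) * ennreal (exp (c d / real S * z)) \<partial>lborel)"
      by (rule distributed_nn_integral[OF normal[OF p(2,3)], symmetric]) simp
    also have "\<dots> = (\<integral>\<^sup>+z. ennreal (exp (c d / real S * z)) \<partial>std_normal)"
      by (rule nn_integral_density[symmetric]) auto
    also have "\<dots> = ennreal (exp ((c d / real S)\<^sup>2 / 2))" by (rule std_normal_mgf)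
    finally show "(\<integral>\<^sup>+\<omega>. ennreal (exp (c (fst p) / real S * (case p of (d, s) \<Rightarrow> Z d s) \<omega>)) \<partial>M)
        = ennreal (exp ((c (fst p) / real S)\<^sup>2 / 2))"
      by (simp add: p)
  qed
  also have "\<dots> = ennreal (exp (\<Sum>p\<in>?I. (c (fst p) / real S)\<^sup>2 / 2))"
    by (subst exp_sum) (simp_all add: prod_ennreal)
  also have "(\<Sum>p\<in>?I. (c (fst p) / real S)\<^sup>2 / 2) = (\<Sum>d<D. \<Sum>s<S. (c d / real S)\<^sup>2 / 2)"
    unfolding sum.cartesian_product by (intro sum.cong) auto
  also have "\<dots> = (\<Sum>d<D. (c d)\<^sup>2 / real S) / 2"
  proof -
    have "(\<Sum>s<S. (c d / real S)\<^sup>2 / 2) = (c d)\<^sup>2 / real S / 2" for d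
      using S by (simp add: power2_eq_square)
    then show ?thesis by (simp only: sum_divide_distrib)
  qed
  finally show ?thesis .
qed

section \<open>Independent maps with values in different types\<close>

text \<open>The two maps of \<^const>\<open>prob_space.indep_var\<close> share one value type; here a pair of vectors has to be
  independent of a single vector.\<close>

definition (in prob_space) indep_maps ::
    "'b measure \<Rightarrow> ('a \<Rightarrow> 'b) \<Rightarrow> 'c measure \<Rightarrow> ('a \<Rightarrow> 'c) \<Rightarrow> bool" where
  "indep_maps S X T Y \<longleftrightarrow> X \<in> measurable M S \<and> Y \<in> measurable M T \<and>
     (\<forall>A\<in>sets S. \<forall>B\<in>sets T. prob ((X -` A \<inter> space M) \<inter> (Y -` B \<inter> space M))
        = prob (X -` A \<inter> space M) * prob (Y -` B \<inter> space M))"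

lemma (in prob_space) indep_maps_rv:
  assumes "indep_maps S X T Y"
  shows "X \<in> measurable M S" "Y \<in> measurable M T"
  using assms by (simp_all add: indep_maps_def)

lemma (in prob_space) indep_maps_sym:
  assumes "indep_maps S X T Y"
  shows "indep_maps T Y S X"
  using assms by (simp add: indep_maps_def Int_commute mult.commute)

lemma (in prob_space) indep_maps_if_indep_var:
  assumes "indep_var S X T Y"
  shows "indep_maps S X T Y"
  using assms unfolding indep_var_eq indep_maps_def by (auto intro!: indep_setD)

lemma (in prob_space) indep_maps_if_indep_set:
  assumes "X \<in> measurable M S" "Y \<in> measurable M T"
    and "indep_set (sets (vimage_algebra (space M) X S)) (sets (vimage_algebra (space M) Y T))"
  shows "indep_maps S X T Y"
  using assms unfolding indep_maps_def sets_vimage_algebra by (auto intro!: indep_setD)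

lemma (in prob_space) indep_maps_compose:
  assumes indep: "indep_maps S X T Y" and \<phi>: "\<phi> \<in> measurable S S'" and \<psi>: "\<psi> \<in> measurable T T'"
  shows "indep_maps S' (\<lambda>\<omega>. \<phi> (X \<omega>)) T' (\<lambda>\<omega>. \<psi> (Y \<omega>))"
proof -
  note rv = indep_maps_rv[OF indep]
  have X: "(\<lambda>\<omega>. \<phi> (X \<omega>)) -` A \<inter> space M = X -` (\<phi> -` A \<inter> space S) \<inter> space M" for A
    using measurable_space[OF rv(1)] by auto
  have Y: "(\<lambda>\<omega>. \<psi> (Y \<omega>)) -` B \<inter> space M = Y -` (\<psi> -` B \<inter> space T) \<inter> space M" for B
    using measurable_space[OF rv(2)] by auto
  have prod: "prob ((X -` A \<inter> space M) \<inter> (Y -` B \<inter> space M)) = prob (X -` A \<inter> space M) * prob (Y -` B \<inter> space M)"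
    if "A \<in> sets S" "B \<in> sets T" for A B
    using indep that by (simp add: indep_maps_def)
  then show ?thesis
    unfolding indep_maps_def X Y
    by (intro conjI ballI measurable_compose[OF _ \<phi>] measurable_compose[OF _ \<psi>] rv
        prod measurable_sets[OF \<phi>] measurable_sets[OF \<psi>])
qed

lemma (in prob_space) distr_indep_maps:
  assumes indep: "indep_maps S X T Y"
  shows "distr M S X \<Otimes>\<^sub>M distr M T Y = distr M (S \<Otimes>\<^sub>M T) (\<lambda>\<omega>. (X \<omega>, Y \<omega>))"
proof (rule pair_measure_eqI)
  note [measurable] = indep_maps_rv[OF indep]
  show "sigma_finite_measure (distr M S X)" "sigma_finite_measure (distr M T Y)"
    by (intro prob_space_imp_sigma_finite prob_space_distr; measurable)+
  show "sets (distr M S X \<Otimes>\<^sub>M distr M T Y) = sets (distr M (S \<Otimes>\<^sub>M T) (\<lambda>\<omega>. (X \<omega>, Y \<omega>)))" by simp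
  fix A B assume AB: "A \<in> sets (distr M S X)" "B \<in> sets (distr M T Y)"
  have "(\<lambda>\<omega>. (X \<omega>, Y \<omega>)) -` (A \<times> B) \<inter> space M = (X -` A \<inter> space M) \<inter> (Y -` B \<inter> space M)" by auto
  then show "emeasure (distr M S X) A * emeasure (distr M T Y) B
      = emeasure (distr M (S \<Otimes>\<^sub>M T) (\<lambda>\<omega>. (X \<omega>, Y \<omega>))) (A \<times> B)"
    using indep AB by (simp add: emeasure_distr emeasure_eq_measure indep_maps_def ennreal_mult)
qed

text \<open>In the expectation of a function of independent maps, one of the maps may be evaluated at a freshly
  sampled outcome, drawn either first or last.\<close>

lemma (in prob_space) nn_integral_indep_maps:
  assumes indep: "indep_maps S X T Y" and G[measurable]: "G \<in> borel_measurable (S \<Otimes>\<^sub>M T)"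
  shows "(\<integral>\<^sup>+\<omega>. G (X \<omega>, Y \<omega>) \<partial>M) = (\<integral>\<^sup>+\<omega>. \<integral>\<^sup>+\<omega>'. G (X \<omega>, Y \<omega>') \<partial>M \<partial>M)"
    and "(\<integral>\<^sup>+\<omega>. G (X \<omega>, Y \<omega>) \<partial>M) = (\<integral>\<^sup>+\<omega>'. \<integral>\<^sup>+\<omega>. G (X \<omega>, Y \<omega>') \<partial>M \<partial>M)"
proof -
  note [measurable] = indep_maps_rv[OF indep]
  interpret PX: prob_space "distr M S X" by (rule prob_space_distr) measurable
  interpret PY: prob_space "distr M T Y" by (rule prob_space_distr) measurable
  interpret pair_sigma_finite "distr M S X" "distr M T Y" ..
  have G': "G \<in> borel_measurable (distr M S X \<Otimes>\<^sub>M distr M T Y)" using G by simp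
  have "(\<integral>\<^sup>+\<omega>. G (X \<omega>, Y \<omega>) \<partial>M) = integral\<^sup>N (distr M (S \<Otimes>\<^sub>M T) (\<lambda>\<omega>. (X \<omega>, Y \<omega>))) G"
    by (rule nn_integral_distr[symmetric]) measurable
  also have "\<dots> = integral\<^sup>N (distr M S X \<Otimes>\<^sub>M distr M T Y) G"
    by (simp add: distr_indep_maps[OF indep])
  finally have prod: "(\<integral>\<^sup>+\<omega>. G (X \<omega>, Y \<omega>) \<partial>M) = integral\<^sup>N (distr M S X \<Otimes>\<^sub>M distr M T Y) G" .
  have fix_X: "(\<lambda>v. G (u, v)) \<in> borel_measurable T" if "u \<in> space S" for u
    using that by measurable
  have fix_Y: "(\<lambda>u. G (u, v)) \<in> borel_measurable S" if "v \<in> space T" for v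
    using that by measurable
  have inner_Y: "(\<integral>\<^sup>+v. G (u, v) \<partial>distr M T Y) = (\<integral>\<^sup>+\<omega>'. G (u, Y \<omega>') \<partial>M)" if "u \<in> space S" for u
    using fix_X[OF that] by (intro nn_integral_distr) auto
  have inner_X: "(\<integral>\<^sup>+u. G (u, v) \<partial>distr M S X) = (\<integral>\<^sup>+\<omega>. G (X \<omega>, v) \<partial>M)" if "v \<in> space T" for v
    using fix_Y[OF that] by (intro nn_integral_distr) auto
  have "(\<integral>\<^sup>+u. \<integral>\<^sup>+v. G (u, v) \<partial>distr M T Y \<partial>distr M S X) = (\<integral>\<^sup>+\<omega>. \<integral>\<^sup>+v. G (X \<omega>, v) \<partial>distr M T Y \<partial>M)"
    using PY.borel_measurable_nn_integral_fst[OF G'] by (intro nn_integral_distr) auto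
  also have "\<dots> = (\<integral>\<^sup>+\<omega>. \<integral>\<^sup>+\<omega>'. G (X \<omega>, Y \<omega>') \<partial>M \<partial>M)"
    by (intro nn_integral_cong inner_Y) (rule measurable_space[of X M S], auto)
  finally show "(\<integral>\<^sup>+\<omega>. G (X \<omega>, Y \<omega>) \<partial>M) = (\<integral>\<^sup>+\<omega>. \<integral>\<^sup>+\<omega>'. G (X \<omega>, Y \<omega>') \<partial>M \<partial>M)"
    using prod PY.nn_integral_fst[OF G'] by simp
  have "(\<integral>\<^sup>+v. \<integral>\<^sup>+u. G (u, v) \<partial>distr M S X \<partial>distr M T Y) = (\<integral>\<^sup>+\<omega>'. \<integral>\<^sup>+u. G (u, Y \<omega>') \<partial>distr M S X \<partial>M)"
    using PX.borel_measurable_nn_integral_fst[OF measurable_pair_swap[OF G']]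
    by (intro nn_integral_distr) auto
  also have "\<dots> = (\<integral>\<^sup>+\<omega>'. \<integral>\<^sup>+\<omega>. G (X \<omega>, Y \<omega>') \<partial>M \<partial>M)"
    by (intro nn_integral_cong inner_X) (rule measurable_space[of Y M T], auto)
  finally show "(\<integral>\<^sup>+\<omega>. G (X \<omega>, Y \<omega>) \<partial>M) = (\<integral>\<^sup>+\<omega>'. \<integral>\<^sup>+\<omega>. G (X \<omega>, Y \<omega>') \<partial>M \<partial>M)"
    using prod nn_integral_snd[OF G'] by simp
qed

section \<open>Gaussian process regression with given noise variances\<close>

lemma sum_fun_upd_lessThan_Suc:
  "(\<Sum>i<Suc D. f ((u(D := z)) i) ((v(D := t)) i) i) = (\<Sum>i<D. f (u i) (v i) i) + f z t D"
proof -
  have "(\<Sum>i<D. f ((u(D := z)) i) ((v(D := t)) i) i) = (\<Sum>i<D. f (u i) (v i) i)"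
    by (rule sum.cong) auto
  then show ?thesis by simp
qed

locale gp_regression =
  fixes X :: "'a set" and k :: "'a \<Rightarrow> 'a \<Rightarrow> real" and D S :: nat and xs :: "nat \<Rightarrow> 'a" and x :: 'a
  assumes spd: "strictly_pos_def_kernel X k" and S_pos: "S \<ge> 1"
    and inj_xs: "inj_on xs {..<D}" and xs_in: "xs ` {..<D} \<subseteq> X" and x_in: "x \<in> X"
begin

abbreviation "K \<equiv> K_tilde k D S xs"

abbreviation "\<kappa> \<equiv> k_vec k D xs x"

lemma gram_pos_def: "inj_on p {..<N} \<Longrightarrow> p ` {..<N} \<subseteq> X \<Longrightarrow> pos_def_mat N (gram_mat k N p)"
  using spd by (simp add: strictly_pos_def_kernel_def)

lemma kernel_diag_pos: "k x x > 0"
proof -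
  have "pos_def_mat 1 (gram_mat k 1 (\<lambda>_. x))"
    using x_in by (intro gram_pos_def) (auto simp: inj_on_def)
  moreover have "Matrix.vec 1 (\<lambda>_. 1 :: real) \<noteq> 0\<^sub>v 1"
    by (auto dest: arg_cong[of _ _ "\<lambda>v. vec_index v 0"])
  ultimately have "Matrix.vec 1 (\<lambda>_. 1 :: real) \<bullet> (gram_mat k 1 (\<lambda>_. x) *\<^sub>v Matrix.vec 1 (\<lambda>_. 1)) > 0"
    unfolding pos_def_mat_def by auto
  then show ?thesis by (subst (asm) quadratic_form_sum) (auto simp: gram_mat_def)
qed

lemma kernel_sym:
  assumes "u \<in> X" "v \<in> X"
  shows "k u v = k v u"
proof (cases "u = v")
  case False
  let ?p = "\<lambda>i. if i = 0 then u else v"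
  have "inj_on ?p {..<2::nat}" using False by (auto simp: inj_on_def less_2_cases_iff)
  then have "pos_def_mat 2 (gram_mat k 2 ?p)"
    using assms by (intro gram_pos_def) auto
  then have "transpose_mat (gram_mat k 2 ?p) $$ (0, 1) = gram_mat k 2 ?p $$ (0, 1)"
    by (simp add: pos_def_mat_def)
  then show ?thesis by (simp add: gram_mat_def)
qed simp

lemma K_carrier: "K hs \<in> carrier_mat D D"
  by (simp add: K_tilde_def gram_mat_def mat_diag_def)

lemma K_index: "i < D \<Longrightarrow> j < D \<Longrightarrow> K hs $$ (i, j) = k (xs i) (xs j) + (if i = j then exp (hs j) / real S else 0)"
  by (simp add: K_tilde_def gram_mat_def mat_diag_def)

lemma K_form:
  "Matrix.vec D b \<bullet> (K hs *\<^sub>v Matrix.vec D b)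
   = (\<Sum>i<D. \<Sum>j<D. b i * b j * k (xs i) (xs j)) + (\<Sum>i<D. (b i)\<^sup>2 * exp (hs i) / real S)"
proof -
  have "(\<Sum>j<D. b i * b j * K hs $$ (i, j))
      = (\<Sum>j<D. b i * b j * k (xs i) (xs j)) + (b i)\<^sup>2 * exp (hs i) / real S" if "i < D" for i
  proof -
    have "(\<Sum>j<D. b i * b j * K hs $$ (i, j))
      = (\<Sum>j<D. b i * b j * k (xs i) (xs j)) + (\<Sum>j<D. if i = j then b i * b j * (exp (hs j) / real S) else 0)"
      unfolding sum.distrib[symmetric] using that
      by (intro sum.cong) (auto simp: K_index distrib_left)
    then show ?thesis using that by (simp add: power2_eq_square)
  qed
  then show ?thesis
    by (simp add: quadratic_form_sum[OF K_carrier] sum.distrib)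
qed

lemma noise_form_pos:
  assumes "Matrix.vec D b \<noteq> 0\<^sub>v D"
  shows "(\<Sum>i<D. (b i)\<^sup>2 * exp (hs i) / real S) > 0"
proof -
  obtain i where i: "i < D" "b i \<noteq> 0" using assms by (auto simp: vec_eq_iff)
  then show ?thesis using S_pos by (intro sum_pos2[of _ i]) auto
qed

lemma K_pos_def: "pos_def_mat D (K hs)"
  unfolding pos_def_mat_def
proof (intro conjI ballI impI)
  show "transpose_mat (K hs) = K hs"
    using K_carrier[of hs] xs_in by (intro eq_matI) (auto simp: K_index intro!: kernel_sym)
  fix v :: "real vec" assume v: "v \<in> carrier_vec D" "v \<noteq> 0\<^sub>v D"
  have vec: "v = Matrix.vec D (\<lambda>i. v $ i)" using v by auto
  have "(\<Sum>i<D. \<Sum>j<D. v $ i * v $ j * k (xs i) (xs j)) \<ge> 0" by (rule kernel_form_nonneg[OF spd xs_in])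
  moreover have "(\<Sum>i<D. (v $ i)\<^sup>2 * exp (hs i) / real S) > 0"
    using v(2) vec by (intro noise_form_pos) simp
  ultimately show "v \<bullet> (K hs *\<^sub>v v) > 0"
    by (subst (1 2) vec) (simp add: K_form)
qed (rule K_carrier)

text \<open>The test input is appended to the training inputs as point number \<open>D\<close>.\<close>

lemma extended_form:
  "(\<Sum>i<Suc D. \<Sum>j<Suc D. (b(D := a)) i * (b(D := a)) j * k ((xs(D := x)) i) ((xs(D := x)) j))
   = (\<Sum>i<D. \<Sum>j<D. b i * b j * k (xs i) (xs j)) + 2 * a * (Matrix.vec D b \<bullet> \<kappa>) + a\<^sup>2 * k x x"
proof -
  have "(\<Sum>i<D. b i * a * k (xs i) x) = a * (\<Sum>i<D. b i * k x (xs i))"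
    using xs_in x_in by (auto simp: sum_distrib_left kernel_sym[of _ x] intro!: sum.cong)
  moreover have "(\<Sum>j<D. a * b j * k x (xs j)) = a * (\<Sum>i<D. b i * k x (xs i))"
    by (simp add: sum_distrib_left mult.assoc)
  ultimately show ?thesis
    by (simp only: sum_fun_upd_lessThan_Suc[where f = "\<lambda>c p j. (b(D := a)) i * c * k ((xs(D := x)) i) p" for i]
        sum_fun_upd_lessThan_Suc[where f = "\<lambda>c p i. (\<Sum>j<D. c * b j * k p (xs j)) + c * a * k p x"])
       (simp add: sum.distrib k_vec_def scalar_prod_vec power2_eq_square)
qed

lemma post_mean_eq:
  "post_mean k D S xs x hs ys = (\<Sum>i<D. (inv_mat (K hs) *\<^sub>v \<kappa>) $ i * ys i)"
proof -
  have \<kappa>: "\<kappa> \<in> carrier_vec D" by (simp add: k_vec_def)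
  have v: "inv_mat (K hs) *\<^sub>v \<kappa> = Matrix.vec D (\<lambda>i. (inv_mat (K hs) *\<^sub>v \<kappa>) $ i)"
    using pos_def_mat_inv(1)[OF K_pos_def \<kappa>, of hs] by (intro eq_vecI) (auto simp del: dim_mult_mat_vec)
  have "post_mean k D S xs x hs ys = Matrix.vec D ys \<bullet> (inv_mat (K hs) *\<^sub>v \<kappa>)"
    unfolding post_mean_def using pos_def_mat_sym(2)[OF K_pos_def \<kappa>] by simp
  then show ?thesis by (subst (asm) v) (simp add: scalar_prod_vec mult.commute)
qed

text \<open>With \<open>b = K\<inverse> \<kappa>\<close> and \<open>f, \<epsilon>\<close> for the process and the averaged noise, the posterior variance is the
  variance of the prediction error \<open>f x - (\<Sum>i<D. b i * (f (xs i) + \<epsilon> i))\<close>.  The variance of the part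
  without noise is nonnegative, also when \<open>x\<close> is a training input; the noise part is positive unless
  \<open>b = 0\<close>, and then the error is \<open>f x\<close> itself.\<close>

lemma post_var_pos: "post_var k D S xs x hs > 0"
proof -
  have \<kappa>: "\<kappa> \<in> carrier_vec D" by (simp add: k_vec_def)
  define b where "b i = (inv_mat (K hs) *\<^sub>v \<kappa>) $ i" for i
  have b: "inv_mat (K hs) *\<^sub>v \<kappa> = Matrix.vec D b"
    using pos_def_mat_inv(1)[OF K_pos_def \<kappa>, of hs] by (intro eq_vecI) (auto simp: b_def simp del: dim_mult_mat_vec)
  have "K hs *\<^sub>v Matrix.vec D b = \<kappa>"
    using pos_def_mat_inv(2)[OF K_pos_def \<kappa>, of hs] by (simp add: b)
  then have form: "Matrix.vec D b \<bullet> \<kappa>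
      = (\<Sum>i<D. \<Sum>j<D. b i * b j * k (xs i) (xs j)) + (\<Sum>i<D. (b i)\<^sup>2 * exp (hs i) / real S)"
    using K_form[of b hs] by simp
  have var: "post_var k D S xs x hs = k x x - Matrix.vec D b \<bullet> \<kappa>"
    unfolding post_var_def b using \<kappa> by (simp add: comm_scalar_prod[of \<kappa> D])
  show ?thesis
  proof (cases "Matrix.vec D b = 0\<^sub>v D")
    case True
    then show ?thesis using var kernel_diag_pos \<kappa> by simp
  next
    case False
    have points: "(xs(D := x)) ` {..<Suc D} \<subseteq> X" using xs_in x_in by (auto simp: less_Suc_eq)
    have neg: "Matrix.vec D (\<lambda>i. - b i) \<bullet> \<kappa> = - (Matrix.vec D b \<bullet> \<kappa>)"
      by (simp add: k_vec_def scalar_prod_vec sum_negf)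
    have "0 \<le> (\<Sum>i<D. \<Sum>j<D. b i * b j * k (xs i) (xs j)) - 2 * (Matrix.vec D b \<bullet> \<kappa>) + k x x"
      using kernel_form_nonneg[OF spd points, of "(\<lambda>i. - b i)(D := 1)"]
      unfolding extended_form neg by simp
    then show ?thesis using noise_form_pos[OF False, of hs] form var by linarith
  qed
qed

lemma measurable_inv_K_form:
  assumes u: "\<And>i. i < D \<Longrightarrow> (\<lambda>\<omega>. u \<omega> i) \<in> borel_measurable N" and v: "\<And>i. i < D \<Longrightarrow> (\<lambda>\<omega>. v \<omega> i) \<in> borel_measurable N"
    and hs: "\<And>i. i < D \<Longrightarrow> (\<lambda>\<omega>. hs \<omega> i) \<in> borel_measurable N"
  shows "(\<lambda>\<omega>. Matrix.vec D (u \<omega>) \<bullet> (inv_mat (K (hs \<omega>)) *\<^sub>v Matrix.vec D (v \<omega>))) \<in> borel_measurable N"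
proof -
  have det: "Determinant.det (K (hs \<omega>)) \<noteq> 0" for \<omega> by (rule det_pos_def_mat[OF K_pos_def])
  have "(\<lambda>\<omega>. K (hs \<omega>) $$ (i, j)) \<in> borel_measurable N" if "i < D" "j < D" for i j
    using that hs[of j] by (simp add: K_index)
  then have "(\<lambda>\<omega>. inv_mat (K (hs \<omega>)) $$ (i, j)) \<in> borel_measurable N" if "i < D" "j < D" for i j
    using that by (intro measurable_inv_mat[where A = "\<lambda>\<omega>. K (hs \<omega>)", OF K_carrier det])
  then show ?thesis
    unfolding quadratic_form_sum[OF inv_mat(1)[OF K_carrier det]]
    by (intro borel_measurable_sum borel_measurable_times u v) auto
qed

text \<open>These are the averaged outputs when \<open>F\<close> holds the values of the process at the training inputs (and at
  the test input, as entry \<open>D\<close>), \<open>hs\<close> the logarithmic noise variances and \<open>E\<close> the averages of the normalized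
  noises: \<open>exp (hs i / 2)\<close> is the standard deviation of the noise.\<close>

definition noisy_values :: "(nat \<Rightarrow> real) \<Rightarrow> (nat \<Rightarrow> real) \<Rightarrow> (nat \<Rightarrow> real) \<Rightarrow> nat \<Rightarrow> real" where
  "noisy_values hs F E = (\<lambda>i\<in>{..<D}. F i + exp (hs i / 2) * E i)"

text \<open>The distribution function at \<open>\<gamma>\<close> of the normal law with the posterior mean and variance.\<close>

definition cond_prob_le :: "real \<Rightarrow> (nat \<Rightarrow> real) \<Rightarrow> (nat \<Rightarrow> real) \<Rightarrow> real" where
  "cond_prob_le \<gamma> hs ys =
     1 - erfc ((\<gamma> - post_mean k D S xs x hs ys) / (sqrt 2 * sqrt (post_var k D S xs x hs))) / 2"

lemma cond_prob_le_std_normal: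
  "cond_prob_le \<gamma> hs ys
   = measure std_normal {z. post_mean k D S xs x hs ys + sqrt (post_var k D S xs x hs) * z \<le> \<gamma>}"
proof -
  have "{z. post_mean k D S xs x hs ys + sqrt (post_var k D S xs x hs) * z \<le> \<gamma>}
      = {..(\<gamma> - post_mean k D S xs x hs ys) / sqrt (post_var k D S xs x hs)}"
    using post_var_pos[of hs] by (auto simp: field_simps)
  then show ?thesis by (simp add: measure_std_normal_atMost cond_prob_le_def mult.commute)
qed

lemma measurable_post_mean [measurable]:
  assumes [measurable]: "hs \<in> measurable N (\<Pi>\<^sub>M i\<in>{..<D}. borel)" "ys \<in> measurable N (\<Pi>\<^sub>M i\<in>{..<D}. borel)"
  shows "(\<lambda>\<omega>. post_mean k D S xs x (hs \<omega>) (ys \<omega>)) \<in> borel_measurable N"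
  unfolding post_mean_def k_vec_def by (rule measurable_inv_K_form) measurable

lemma measurable_cond_prob_le [measurable]:
  assumes [measurable]: "hs \<in> measurable N (\<Pi>\<^sub>M i\<in>{..<D}. borel)" "ys \<in> measurable N (\<Pi>\<^sub>M i\<in>{..<D}. borel)"
  shows "(\<lambda>\<omega>. cond_prob_le \<gamma> (hs \<omega>) (ys \<omega>)) \<in> borel_measurable N"
proof -
  have [measurable]: "(\<lambda>\<omega>. post_var k D S xs x (hs \<omega>)) \<in> borel_measurable N"
    unfolding post_var_def k_vec_def by (intro borel_measurable_diff borel_measurable_const measurable_inv_K_form) measurable
  show ?thesis unfolding cond_prob_le_def by measurable
qed

lemma measurable_noisy_values [measurable]:
  assumes [measurable]: "hs \<in> measurable N (\<Pi>\<^sub>M i\<in>{..<D}. borel)" "F \<in> measurable N (\<Pi>\<^sub>M i\<in>{..<Suc D}. borel)"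
    "E \<in> measurable N (\<Pi>\<^sub>M i\<in>{..<D}. borel)"
  shows "(\<lambda>\<omega>. noisy_values (hs \<omega>) (F \<omega>) (E \<omega>)) \<in> measurable N (\<Pi>\<^sub>M i\<in>{..<D}. borel)"
proof -
  have [measurable]: "(\<lambda>\<omega>. F \<omega> i) \<in> borel_measurable N" if "i < D" for i
    using that by (intro measurable_compose[OF assms(2) measurable_component_singleton]) auto
  show ?thesis unfolding noisy_values_def by (intro measurable_restrict) auto
qed

end

section \<open>The posterior law\<close>

lemma measurable_append_coordinate:
  fixes Y :: "'a \<Rightarrow> nat \<Rightarrow> real"
  assumes Y: "Y \<in> measurable N (\<Pi>\<^sub>M i\<in>{..<D}. borel)" and Z: "Z \<in> borel_measurable N"
  shows "(\<lambda>\<omega>. \<lambda>i\<in>{..<Suc D}. if i < D then Y \<omega> i else Z \<omega>) \<in> measurable N (\<Pi>\<^sub>M i\<in>{..<Suc D}. borel)"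
proof (rule measurable_restrict)
  fix i
  show "(\<lambda>\<omega>. if i < D then Y \<omega> i else Z \<omega>) \<in> borel_measurable N"
    using Z by (cases "i < D") (auto intro: measurable_compose[OF Y measurable_component_singleton])
qed

lemma nn_integral_law:
  assumes "T \<in> measurable N P" "\<phi> \<in> borel_measurable P"
  shows "(\<integral>\<^sup>+v. \<phi> v \<partial>distr N P T) = (\<integral>\<^sup>+\<omega>. \<phi> (T \<omega>) \<partial>N)"
  using assms by (simp add: nn_integral_distr)

context gp_regression
begin

text \<open>\<open>F\<close> stands for the process at the training inputs and at the test input, \<open>E\<close> for the averaged
  normalized noises.  Their moment generating functions say that they are centred normal vectors, of
  covariances \<open>k (p i) (p j)\<close> at the inputs \<open>p = xs(D := x)\<close> and \<open>1 / S\<close> times the identity.\<close>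

context
  fixes M :: "'w measure" and F E :: "'w \<Rightarrow> nat \<Rightarrow> real"
  assumes prob: "prob_space M"
    and F: "F \<in> measurable M (\<Pi>\<^sub>M i\<in>{..<Suc D}. borel)"
    and indep_F_E: "prob_space.indep_maps M (\<Pi>\<^sub>M i\<in>{..<Suc D}. borel) F (\<Pi>\<^sub>M i\<in>{..<D}. borel) E"
    and mgf_F: "\<And>c. (\<integral>\<^sup>+\<omega>. ennreal (exp (\<Sum>i<Suc D. c i * F \<omega> i)) \<partial>M)
      = ennreal (exp ((\<Sum>i<Suc D. \<Sum>j<Suc D. c i * c j * k ((xs(D := x)) i) ((xs(D := x)) j)) / 2))"
    and mgf_E: "\<And>c. (\<integral>\<^sup>+\<omega>. ennreal (exp (\<Sum>d<D. c d * E \<omega> d)) \<partial>M) = ennreal (exp ((\<Sum>d<D. (c d)\<^sup>2 / real S) / 2))"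
begin

interpretation prob_space M by (rule prob)

lemma E_measurable: "E \<in> measurable M (\<Pi>\<^sub>M i\<in>{..<D}. borel)"
  using indep_F_E by (rule indep_maps_rv(2))

lemma F_component [measurable]: "i \<le> D \<Longrightarrow> (\<lambda>\<omega>. F \<omega> i) \<in> borel_measurable M"
  by (rule measurable_compose[OF F measurable_component_singleton]) auto

lemma measurable_noisy_values_fixed: "(\<lambda>\<omega>. noisy_values hs (F \<omega>) (E \<omega>)) \<in> measurable M (\<Pi>\<^sub>M i\<in>{..<D}. borel)"
proof -
  have "(\<lambda>\<omega>. \<lambda>i\<in>{..<D}. hs i) \<in> measurable M (\<Pi>\<^sub>M i\<in>{..<D}. borel)" by (intro measurable_restrict) auto
  from measurable_noisy_values[OF this F E_measurable] show ?thesis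
    by (simp add: noisy_values_def restrict_def cong: if_cong)
qed

text \<open>For given noise variances the averaged outputs and \<open>f x\<close> are jointly normal: the averaged outputs have
  covariance matrix \<open>K hs\<close> and covariances \<open>\<kappa>\<close> with \<open>f x\<close>.\<close>

lemma joint_mgf:
  "(\<integral>\<^sup>+\<omega>. ennreal (exp ((\<Sum>i<D. b i * noisy_values hs (F \<omega>) (E \<omega>) i) + a * F \<omega> D)) \<partial>M)
   = ennreal (exp ((Matrix.vec D b \<bullet> (K hs *\<^sub>v Matrix.vec D b) + 2 * a * (Matrix.vec D b \<bullet> \<kappa>) + a\<^sup>2 * k x x) / 2))"
proof -
  let ?eF = "\<lambda>u. ennreal (exp (\<Sum>i<Suc D. (b(D := a)) i * u i))"
  let ?eE = "\<lambda>v. ennreal (exp (\<Sum>d<D. (b d * exp (hs d / 2)) * v d))"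
  let ?PF = "\<Pi>\<^sub>M i\<in>{..<Suc D}. (borel :: real measure)" and ?PE = "\<Pi>\<^sub>M i\<in>{..<D}. (borel :: real measure)"
  have eF: "?eF \<in> borel_measurable ?PF" by measurable
  have eE: "?eE \<in> borel_measurable ?PE" by measurable
  have split: "ennreal (exp ((\<Sum>i<D. b i * noisy_values hs (F \<omega>) (E \<omega>) i) + a * F \<omega> D)) = ?eF (F \<omega>) * ?eE (E \<omega>)" for \<omega>
  proof -
    have "(\<Sum>i<D. b i * noisy_values hs (F \<omega>) (E \<omega>) i)
        = (\<Sum>i<D. b i * F \<omega> i) + (\<Sum>d<D. (b d * exp (hs d / 2)) * E \<omega> d)"
      by (simp add: noisy_values_def distrib_left sum.distrib mult.assoc)
    moreover have "(\<Sum>i<Suc D. (b(D := a)) i * F \<omega> i) = (\<Sum>i<D. b i * F \<omega> i) + a * F \<omega> D"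
      by (simp add: sum.lessThan_Suc)
    ultimately show ?thesis by (simp add: ennreal_mult[symmetric] mult_exp_exp ac_simps)
  qed
  have "(\<integral>\<^sup>+\<omega>. ?eF (F \<omega>) * ?eE (E \<omega>) \<partial>M) = (\<integral>\<^sup>+\<omega>. \<integral>\<^sup>+\<omega>'. ?eF (F \<omega>) * ?eE (E \<omega>') \<partial>M \<partial>M)"
    using nn_integral_indep_maps(1)[OF indep_F_E, of "\<lambda>(u, v). ?eF u * ?eE v"] by simp
  also have "\<dots> = (\<integral>\<^sup>+\<omega>. ?eF (F \<omega>) \<partial>M) * (\<integral>\<^sup>+\<omega>. ?eE (E \<omega>) \<partial>M)"
    using measurable_compose[OF F eF] measurable_compose[OF E_measurable eE]
    by (simp only: nn_integral_cmult nn_integral_multc)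
  also have "\<dots> = ennreal (exp (((\<Sum>i<D. \<Sum>j<D. b i * b j * k (xs i) (xs j)) + 2 * a * (Matrix.vec D b \<bullet> \<kappa>) + a\<^sup>2 * k x x) / 2))
      * ennreal (exp ((\<Sum>d<D. (b d)\<^sup>2 * exp (hs d) / real S) / 2))"
    unfolding mgf_F mgf_E extended_form
    by (simp add: power_mult_distrib exp_double[symmetric])
  also have "\<dots> = ennreal (exp ((Matrix.vec D b \<bullet> (K hs *\<^sub>v Matrix.vec D b) + 2 * a * (Matrix.vec D b \<bullet> \<kappa>) + a\<^sup>2 * k x x) / 2))"
    unfolding K_form by (simp add: ennreal_mult[symmetric] mult_exp_exp add_divide_distrib ac_simps)
  finally show ?thesis unfolding split .
qed

text \<open>Jointly with the averaged outputs \<open>Y\<close>, the value \<open>f x\<close> is distributed like the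
  posterior mean plus independent normal noise with the posterior variance.  In the moment generating
  function of the right hand side, the posterior mean is linear in \<open>Y\<close> and shifts the parameter of \<open>Y\<close> by a
  multiple of \<open>K\<inverse> \<kappa>\<close>, so that \<open>quadratic_form_shift\<close> gives the function of the left hand side.\<close>

lemma conditional_law:
  defines "Y \<equiv> \<lambda>hs \<omega>. noisy_values hs (F \<omega>) (E \<omega>)"
  shows "distr M (\<Pi>\<^sub>M i\<in>{..<Suc D}. borel) (\<lambda>\<omega>. \<lambda>i\<in>{..<Suc D}. if i < D then Y hs \<omega> i else F \<omega> D)
       = distr (M \<Otimes>\<^sub>M std_normal) (\<Pi>\<^sub>M i\<in>{..<Suc D}. borel)
          (\<lambda>(\<omega>, z). \<lambda>i\<in>{..<Suc D}. if i < D then Y hs \<omega> i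
             else post_mean k D S xs x hs (Y hs \<omega>) + sqrt (post_var k D S xs x hs) * z)"
    (is "distr M ?P ?L1 = distr _ ?P ?L2")
proof -
  let ?\<mu> = "\<lambda>\<omega>. post_mean k D S xs x hs (Y hs \<omega>)" and ?v = "post_var k D S xs x hs"
  define \<beta> where "\<beta> i = (inv_mat (K hs) *\<^sub>v \<kappa>) $ i" for i
  have \<kappa>: "\<kappa> \<in> carrier_vec D" by (simp add: k_vec_def)
  interpret N: prob_space std_normal by (rule prob_space_std_normal)
  have Y: "Y hs \<in> measurable M (\<Pi>\<^sub>M i\<in>{..<D}. borel)" unfolding Y_def by (rule measurable_noisy_values_fixed)
  have Y_i[measurable]: "(\<lambda>\<omega>. Y hs \<omega> i) \<in> borel_measurable M" if "i < D" for i
    using that by (intro measurable_compose[OF Y measurable_component_singleton]) auto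
  have \<mu>: "?\<mu> \<omega> = (\<Sum>i<D. \<beta> i * Y hs \<omega> i)" for \<omega> unfolding post_mean_eq \<beta>_def by simp
  have [measurable]: "?\<mu> \<in> borel_measurable M"
    unfolding \<mu> by (intro borel_measurable_sum borel_measurable_times borel_measurable_const Y_i) auto
  have L1: "?L1 \<in> measurable M ?P"
    by (rule measurable_append_coordinate[OF Y F_component]) simp
  have L2: "?L2 \<in> measurable (M \<Otimes>\<^sub>M std_normal) ?P"
    unfolding case_prod_beta
    by (rule measurable_append_coordinate[OF measurable_compose[OF measurable_fst Y]]) measurable
  have exp_meas: "(\<lambda>v. ennreal (exp (\<Sum>i<Suc D. t i * v i))) \<in> borel_measurable ?P" for t by measurable
  let ?q = "\<lambda>t. (Matrix.vec D t \<bullet> (K hs *\<^sub>v Matrix.vec D t) + 2 * t D * (Matrix.vec D t \<bullet> \<kappa>) + (t D)\<^sup>2 * k x x) / 2"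
  have mgf1: "(\<integral>\<^sup>+v. ennreal (exp (\<Sum>i<Suc D. t i * v i)) \<partial>distr M ?P ?L1) = ennreal (exp (?q t))" for t
  proof -
    have "(\<Sum>i<Suc D. t i * ?L1 \<omega> i) = (\<Sum>i<D. t i * Y hs \<omega> i) + t D * F \<omega> D" for \<omega>
      by simp
    then show ?thesis
      unfolding nn_integral_law[OF L1 exp_meas] by (simp only: Y_def joint_mgf)
  qed
  have mgf2: "(\<integral>\<^sup>+v. ennreal (exp (\<Sum>i<Suc D. t i * v i)) \<partial>distr (M \<Otimes>\<^sub>M std_normal) ?P ?L2) = ennreal (exp (?q t))" for t
  proof -
    let ?a = "t D"
    define s where "s i = t i + ?a * \<beta> i" for i
    let ?eY = "\<lambda>\<omega>. ennreal (exp (\<Sum>i<D. s i * Y hs \<omega> i))"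
    have "(\<Sum>i<Suc D. t i * ?L2 (\<omega>, z) i) = (\<Sum>i<D. s i * Y hs \<omega> i) + (?a * sqrt ?v) * z" for \<omega> z
      by (simp add: \<mu> s_def distrib_left distrib_right sum.distrib sum_distrib_left mult.assoc)
    then have split: "ennreal (exp (\<Sum>i<Suc D. t i * ?L2 (\<omega>, z) i)) = ?eY \<omega> * ennreal (exp ((?a * sqrt ?v) * z))" for \<omega> z
      by (simp add: ennreal_mult[symmetric] mult_exp_exp)
    have eY: "?eY \<in> borel_measurable M"
      by (intro measurable_compose[OF _ measurable_ennreal] borel_measurable_exp borel_measurable_sum
          borel_measurable_times borel_measurable_const Y_i) auto
    have "(\<integral>\<^sup>+v. ennreal (exp (\<Sum>i<Suc D. t i * v i)) \<partial>distr (M \<Otimes>\<^sub>M std_normal) ?P ?L2)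
        = (\<integral>\<^sup>+p. ennreal (exp (\<Sum>i<Suc D. t i * ?L2 p i)) \<partial>(M \<Otimes>\<^sub>M std_normal))"
      by (rule nn_integral_law[OF L2 exp_meas])
    also have "\<dots> = (\<integral>\<^sup>+\<omega>. \<integral>\<^sup>+z. ennreal (exp (\<Sum>i<Suc D. t i * ?L2 (\<omega>, z) i)) \<partial>std_normal \<partial>M)"
      by (rule N.nn_integral_fst[symmetric]) (rule measurable_compose[OF L2 exp_meas])
    also have "\<dots> = (\<integral>\<^sup>+\<omega>. ?eY \<omega> \<partial>M) * (\<integral>\<^sup>+z. ennreal (exp ((?a * sqrt ?v) * z)) \<partial>std_normal)"
      unfolding split using eY by (simp add: nn_integral_cmult nn_integral_multc)
    also have "(\<integral>\<^sup>+\<omega>. ?eY \<omega> \<partial>M) = ennreal (exp ((Matrix.vec D s \<bullet> (K hs *\<^sub>v Matrix.vec D s)) / 2))"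
      using joint_mgf[of s hs 0] by (simp add: Y_def)
    also have "Matrix.vec D s = Matrix.vec D t + ?a \<cdot>\<^sub>v (inv_mat (K hs) *\<^sub>v \<kappa>)"
      using pos_def_mat_inv(1)[OF K_pos_def \<kappa>, of hs]
      by (intro eq_vecI) (auto simp: s_def \<beta>_def simp del: dim_mult_mat_vec)
    also have "\<dots> \<bullet> (K hs *\<^sub>v \<dots>)
        = Matrix.vec D t \<bullet> (K hs *\<^sub>v Matrix.vec D t) + 2 * ?a * (Matrix.vec D t \<bullet> \<kappa>) + ?a\<^sup>2 * (k x x - ?v)"
      using quadratic_form_shift[OF K_pos_def _ \<kappa>, of "Matrix.vec D t"] by (simp add: post_var_def)
    also have "(\<integral>\<^sup>+z. ennreal (exp ((?a * sqrt ?v) * z)) \<partial>std_normal) = ennreal (exp (?a\<^sup>2 * ?v / 2))"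
      using post_var_pos[of hs] by (simp add: std_normal_mgf power_mult_distrib)
    also have "ennreal (exp ((Matrix.vec D t \<bullet> (K hs *\<^sub>v Matrix.vec D t) + 2 * ?a * (Matrix.vec D t \<bullet> \<kappa>)
          + ?a\<^sup>2 * (k x x - ?v)) / 2)) * ennreal (exp (?a\<^sup>2 * ?v / 2)) = ennreal (exp (?q t))"
      by (simp add: ennreal_mult[symmetric] mult_exp_exp add_divide_distrib[symmetric] algebra_simps)
    finally show ?thesis .
  qed
  show ?thesis
    by (rule PiM_measure_eqI_mgf[of "{..<Suc D}"]) (simp_all add: mgf1 mgf2 del: sum.lessThan_Suc)
qed

lemma conditional_prob_fixed_noise:
  assumes B: "B \<in> sets (\<Pi>\<^sub>M i\<in>{..<D}. borel)"
  shows "(\<integral>\<^sup>+\<omega>. indicator B (noisy_values hs (F \<omega>) (E \<omega>)) * indicator {..\<gamma>} (F \<omega> D) \<partial>M)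
       = (\<integral>\<^sup>+\<omega>. indicator B (noisy_values hs (F \<omega>) (E \<omega>))
             * ennreal (cond_prob_le \<gamma> hs (noisy_values hs (F \<omega>) (E \<omega>))) \<partial>M)"
proof -
  let ?P = "\<Pi>\<^sub>M i\<in>{..<Suc D}. (borel :: real measure)"
  let ?Y = "\<lambda>\<omega>. noisy_values hs (F \<omega>) (E \<omega>)"
  let ?\<mu> = "\<lambda>\<omega>. post_mean k D S xs x hs (?Y \<omega>)" and ?\<sigma> = "sqrt (post_var k D S xs x hs)"
  let ?L1 = "\<lambda>\<omega>. \<lambda>i\<in>{..<Suc D}. if i < D then ?Y \<omega> i else F \<omega> D"
  let ?L2 = "\<lambda>(\<omega>, z). \<lambda>i\<in>{..<Suc D}. if i < D then ?Y \<omega> i else ?\<mu> \<omega> + ?\<sigma> * z"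
  let ?\<phi> = "\<lambda>v. indicator B (restrict v {..<D}) * indicator {..\<gamma>} (v D) :: ennreal"
  interpret N: prob_space std_normal by (rule prob_space_std_normal)
  note [measurable] = measurable_noisy_values_fixed[of hs]
  have Y_i[measurable]: "(\<lambda>\<omega>. ?Y \<omega> i) \<in> borel_measurable M" if "i < D" for i
    using that by (intro measurable_compose[OF measurable_noisy_values_fixed measurable_component_singleton]) auto
  have [measurable]: "?\<mu> \<in> borel_measurable M"
    unfolding post_mean_eq by (intro borel_measurable_sum borel_measurable_times borel_measurable_const Y_i) auto
  have L1: "?L1 \<in> measurable M ?P"
    by (rule measurable_append_coordinate[OF measurable_noisy_values_fixed F_component]) simp
  have L2: "?L2 \<in> measurable (M \<Otimes>\<^sub>M std_normal) ?P"
    unfolding case_prod_beta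
    by (rule measurable_append_coordinate[OF measurable_compose[OF measurable_fst measurable_noisy_values_fixed]]) measurable
  have "(\<lambda>v. restrict v {..<D}) \<in> measurable ?P (\<Pi>\<^sub>M i\<in>{..<D}. borel)"
    by (rule measurable_restrict_subset) auto
  moreover have "(\<lambda>v. v D) \<in> borel_measurable ?P" by measurable
  ultimately have \<phi>: "?\<phi> \<in> borel_measurable ?P"
    using B by (intro borel_measurable_times_ennreal) (auto intro: measurable_compose[OF _ borel_measurable_indicator])
  have restr: "restrict (\<lambda>i\<in>{..<Suc D}. if i < D then ?Y \<omega> i else r) {..<D} = ?Y \<omega>" for \<omega> r
    by (auto simp: noisy_values_def)
  have "(\<integral>\<^sup>+\<omega>. indicator B (?Y \<omega>) * indicator {..\<gamma>} (F \<omega> D) \<partial>M) = (\<integral>\<^sup>+v. ?\<phi> v \<partial>distr M ?P ?L1)"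
    unfolding nn_integral_law[OF L1 \<phi>] restr by simp
  also have "\<dots> = (\<integral>\<^sup>+v. ?\<phi> v \<partial>distr (M \<Otimes>\<^sub>M std_normal) ?P ?L2)"
    by (simp only: conditional_law[of hs])
  also have "\<dots> = (\<integral>\<^sup>+\<omega>. \<integral>\<^sup>+z. ?\<phi> (?L2 (\<omega>, z)) \<partial>std_normal \<partial>M)"
    unfolding nn_integral_law[OF L2 \<phi>]
    by (rule N.nn_integral_fst[symmetric]) (rule measurable_compose[OF L2 \<phi>])
  also have "\<dots> = (\<integral>\<^sup>+\<omega>. indicator B (?Y \<omega>) * ennreal (cond_prob_le \<gamma> hs (?Y \<omega>)) \<partial>M)"
  proof (rule nn_integral_cong)
    fix \<omega>
    have "(\<integral>\<^sup>+z. ?\<phi> (?L2 (\<omega>, z)) \<partial>std_normal)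
        = (\<integral>\<^sup>+z. indicator B (?Y \<omega>) * indicator {z. ?\<mu> \<omega> + ?\<sigma> * z \<le> \<gamma>} z \<partial>std_normal)"
      unfolding prod.case restr by (simp add: indicator_def)
    also have "\<dots> = indicator B (?Y \<omega>) * emeasure std_normal {z. ?\<mu> \<omega> + ?\<sigma> * z \<le> \<gamma>}"
      by (simp add: nn_integral_cmult)
    finally show "(\<integral>\<^sup>+z. ?\<phi> (?L2 (\<omega>, z)) \<partial>std_normal)
        = indicator B (?Y \<omega>) * ennreal (cond_prob_le \<gamma> hs (?Y \<omega>))"
      by (simp add: cond_prob_le_std_normal N.emeasure_eq_measure)
  qed
  finally show ?thesis .
qed

text \<open>The noise variances are independent of the process and of the normalized noises, so they can be
  sampled first and held fixed while the other two are averaged.\<close>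

lemma conditional_prob_random_noise:
  assumes indep_F_H: "indep_maps (\<Pi>\<^sub>M i\<in>{..<Suc D}. borel) F (\<Pi>\<^sub>M i\<in>{..<D}. borel) H"
    and indep_FH_E: "indep_maps ((\<Pi>\<^sub>M i\<in>{..<Suc D}. borel) \<Otimes>\<^sub>M (\<Pi>\<^sub>M i\<in>{..<D}. borel)) (\<lambda>\<omega>. (F \<omega>, H \<omega>))
           (\<Pi>\<^sub>M i\<in>{..<D}. borel) E"
    and B: "B \<in> sets (\<Pi>\<^sub>M i\<in>{..<D}. borel)"
  shows "(\<integral>\<^sup>+\<omega>. indicator B (noisy_values (H \<omega>) (F \<omega>) (E \<omega>)) * indicator {..\<gamma>} (F \<omega> D) \<partial>M)
       = (\<integral>\<^sup>+\<omega>. indicator B (noisy_values (H \<omega>) (F \<omega>) (E \<omega>))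
             * ennreal (cond_prob_le \<gamma> (H \<omega>) (noisy_values (H \<omega>) (F \<omega>) (E \<omega>))) \<partial>M)"
proof -
  let ?PF = "\<Pi>\<^sub>M i\<in>{..<Suc D}. (borel :: real measure)" and ?P = "\<Pi>\<^sub>M i\<in>{..<D}. (borel :: real measure)"
  have H: "H \<in> measurable M ?P" using indep_F_H by (rule indep_maps_rv(2))
  have resample: "(\<integral>\<^sup>+\<omega>. G ((F \<omega>, H \<omega>), E \<omega>) \<partial>M) = (\<integral>\<^sup>+\<omega>'. \<integral>\<^sup>+\<omega>. G ((F \<omega>, H \<omega>'), E \<omega>) \<partial>M \<partial>M)"
    if G: "G \<in> borel_measurable ((?PF \<Otimes>\<^sub>M ?P) \<Otimes>\<^sub>M ?P)" for G
  proof -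
    have "(\<lambda>p. G (fst p, E (snd p))) \<in> borel_measurable ((?PF \<Otimes>\<^sub>M ?P) \<Otimes>\<^sub>M M)"
      by (rule measurable_compose[OF _ G]) (intro measurable_Pair measurable_fst measurable_compose[OF measurable_snd E_measurable])
    from borel_measurable_nn_integral_fst[OF this]
    have inner: "(\<lambda>u. \<integral>\<^sup>+\<omega>'. G (u, E \<omega>') \<partial>M) \<in> borel_measurable (?PF \<Otimes>\<^sub>M ?P)" by simp
    have "(\<integral>\<^sup>+\<omega>. G ((F \<omega>, H \<omega>), E \<omega>) \<partial>M) = (\<integral>\<^sup>+\<omega>. \<integral>\<^sup>+\<omega>'. G ((F \<omega>, H \<omega>), E \<omega>') \<partial>M \<partial>M)"
      by (rule nn_integral_indep_maps(1)[OF indep_FH_E G])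
    also have "\<dots> = (\<integral>\<^sup>+\<omega>''. \<integral>\<^sup>+\<omega>. \<integral>\<^sup>+\<omega>'. G ((F \<omega>, H \<omega>''), E \<omega>') \<partial>M \<partial>M \<partial>M)"
      by (rule nn_integral_indep_maps(2)[OF indep_F_H inner])
    also have "\<dots> = (\<integral>\<^sup>+\<omega>''. \<integral>\<^sup>+\<omega>. G ((F \<omega>, H \<omega>''), E \<omega>) \<partial>M \<partial>M)"
    proof (rule nn_integral_cong)
      fix \<omega>'' assume "\<omega>'' \<in> space M"
      then have h: "H \<omega>'' \<in> space ?P" by (rule measurable_space[OF H])
      have "(\<lambda>p. G ((fst p, H \<omega>''), snd p)) \<in> borel_measurable (?PF \<Otimes>\<^sub>M ?P)"
        by (rule measurable_compose[OF _ G]) (intro measurable_Pair measurable_fst measurable_snd measurable_const h)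
      from nn_integral_indep_maps(1)[OF indep_F_E this]
      show "(\<integral>\<^sup>+\<omega>. \<integral>\<^sup>+\<omega>'. G ((F \<omega>, H \<omega>''), E \<omega>') \<partial>M \<partial>M) = (\<integral>\<^sup>+\<omega>. G ((F \<omega>, H \<omega>''), E \<omega>) \<partial>M)" by simp
    qed
    finally show ?thesis .
  qed
  let ?Q = "(?PF \<Otimes>\<^sub>M ?P) \<Otimes>\<^sub>M ?P"
  let ?Y = "\<lambda>q. noisy_values (snd (fst q)) (fst (fst q)) (snd q)"
  have hs_meas: "(\<lambda>q. snd (fst q)) \<in> measurable ?Q ?P" by measurable
  have Y: "?Y \<in> measurable ?Q ?P" by (rule measurable_noisy_values) measurable
  have ind: "(\<lambda>q. indicator B (?Y q) :: ennreal) \<in> borel_measurable ?Q"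
    using B by (intro measurable_compose[OF Y borel_measurable_indicator])
  have "(\<lambda>q. fst (fst q) D) \<in> borel_measurable ?Q"
    by (rule measurable_compose[OF _ measurable_component_singleton[of D "{..<Suc D}"]]) measurable
  then have "(\<lambda>q. indicator {..\<gamma>} (fst (fst q) D) :: ennreal) \<in> borel_measurable ?Q"
    by (rule measurable_compose) simp
  then have G1: "(\<lambda>q. indicator B (?Y q) * indicator {..\<gamma>} (fst (fst q) D) :: ennreal) \<in> borel_measurable ?Q"
    by (intro borel_measurable_times_ennreal ind)
  have G2: "(\<lambda>q. indicator B (?Y q) * ennreal (cond_prob_le \<gamma> (snd (fst q)) (?Y q))) \<in> borel_measurable ?Q"
    by (intro borel_measurable_times_ennreal ind measurable_compose[OF measurable_cond_prob_le[OF hs_meas Y] measurable_ennreal])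
  \<comment> \<open>After resampling, \<open>H\<close> is frozen in the inner integral, where the result for fixed noise applies.\<close>
  show ?thesis
    using resample[OF G1] resample[OF G2] conditional_prob_fixed_noise[OF B] by simp
qed

end

end

section \<open>The conditional distribution function of the process\<close>

lemma (in gp_regression) cond_prob_le_cong:
  assumes hs: "\<And>d. d < D \<Longrightarrow> hs d = hs' d" and ys: "\<And>d. d < D \<Longrightarrow> ys d = ys' d"
  shows "cond_prob_le \<gamma> hs ys = cond_prob_le \<gamma> hs' ys'"
proof -
  have "mat_diag D (\<lambda>d. exp (hs d)) = mat_diag D (\<lambda>d. exp (hs' d))"
    using hs by (intro eq_matI) (auto simp: mat_diag_def)
  moreover have "Matrix.vec D ys = Matrix.vec D ys'" using ys by (intro eq_vecI) auto
  ultimately show ?thesis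
    by (simp add: cond_prob_le_def post_mean_def post_var_def K_tilde_def)
qed

theorem theorem2:
  fixes M :: "'w measure"
    and X :: "(real ^ 'n) set"
    and f g :: "real ^ 'n \<Rightarrow> 'w \<Rightarrow> real"
    and k l :: "real ^ 'n \<Rightarrow> real ^ 'n \<Rightarrow> real"
    and xs :: "nat \<Rightarrow> real ^ 'n"
    and D S :: nat
    and y w :: "nat \<Rightarrow> nat \<Rightarrow> 'w \<Rightarrow> real"
    and x :: "real ^ 'n"
    and \<gamma> :: real
  assumes "prob_space M"
    and "D \<ge> 1" and "S \<ge> 1"
    and "inj_on xs {..<D}" and "xs ` {..<D} \<subseteq> X"
    and g_pos: "\<And>z \<omega>. z \<in> X \<Longrightarrow> \<omega> \<in> space M \<Longrightarrow> g z \<omega> > 0"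
    and gp_f: "gaussian_process M X k f"
    and gp_h: "gaussian_process M X l (log_var g)"
    and indep_f_h:
      "prob_space.indep_var M (path_space X) (path_on X f) (path_space X) (path_on X (log_var g))"
    and obs: "\<And>d s \<omega>. d < D \<Longrightarrow> s < S \<Longrightarrow> \<omega> \<in> space M \<Longrightarrow> y d s \<omega> = f (xs d) \<omega> + w d s \<omega>"
    and noise_normal:
      "\<And>d s. d < D \<Longrightarrow> s < S \<Longrightarrow>
         distributed M lborel (\<lambda>\<omega>. w d s \<omega> / g (xs d) \<omega>) std_normal_density"
    and noise_indep:
      "prob_space.indep_vars M (\<lambda>_. borel) (\<lambda>(d, s) \<omega>. w d s \<omega> / g (xs d) \<omega>) ({..<D} \<times> {..<S})"
    and noise_indep_f_h:
      "prob_space.indep_set M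
         (sets (vimage_algebra (space M)
            (\<lambda>\<omega>. \<lambda>(d, s)\<in>{..<D} \<times> {..<S}. w d s \<omega> / g (xs d) \<omega>)
            (\<Pi>\<^sub>M p\<in>{..<D} \<times> {..<S}. borel)))
         (sets (vimage_algebra (space M)
            (\<lambda>\<omega>. (path_on X f \<omega>, path_on X (log_var g) \<omega>))
            (path_space X \<Otimes>\<^sub>M path_space X)))"
    and "x \<in> X"
  shows "AE \<omega> in M.
    real_cond_exp M (data_algebra M D S y) (indicator {\<omega>' \<in> space M. f x \<omega>' \<le> \<gamma>}) \<omega>
      = 1 - delta M k D S xs (log_var g) y \<gamma> x \<omega>"
proof -
  interpret prob_space M by fact
  interpret gp_regression X k D S xs x
    using gp_f assms(3-5) \<open>x \<in> X\<close> by unfold_locales (auto simp: gaussian_process_def)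
  let ?p = "xs(D := x)"
  let ?PF = "\<Pi>\<^sub>M i\<in>{..<Suc D}. (borel :: real measure)" and ?P = "\<Pi>\<^sub>M i\<in>{..<D}. (borel :: real measure)"
  let ?PZ = "\<Pi>\<^sub>M p\<in>{..<D} \<times> {..<S}. (borel :: real measure)"
  define Z where "Z \<omega> = (\<lambda>(d, s)\<in>{..<D} \<times> {..<S}. w d s \<omega> / g (xs d) \<omega>)" for \<omega>
  define F where "F \<omega> = (\<lambda>i\<in>{..<Suc D}. f (?p i) \<omega>)" for \<omega>
  define H where "H \<omega> = (\<lambda>i\<in>{..<D}. log_var g (xs i) \<omega>)" for \<omega>
  define E where "E \<omega> = (\<lambda>d\<in>{..<D}. (\<Sum>s<S. w d s \<omega> / g (xs d) \<omega>) / real S)" for \<omega>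
  have points: "?p ` {..<Suc D} \<subseteq> X" using xs_in x_in by (auto simp: less_Suc_eq)

  \<comment> \<open>All vectors are measurable functions of the paths and of the noises, and inherit their independence.\<close>
  have paths: "path_on X f \<in> measurable M (path_space X)" "path_on X (log_var g) \<in> measurable M (path_space X)"
    using indep_var_rv1[OF indep_f_h] indep_var_rv2[OF indep_f_h] .
  have eval_F: "(\<lambda>\<phi>. \<lambda>i\<in>{..<Suc D}. \<phi> (?p i)) \<in> measurable (path_space X) ?PF"
    using points by (intro measurable_restrict measurable_component_singleton) auto
  have eval_H: "(\<lambda>\<phi>. \<lambda>i\<in>{..<D}. \<phi> (xs i)) \<in> measurable (path_space X) ?P"
    using xs_in by (intro measurable_restrict measurable_component_singleton) auto
  have mean_Z: "(\<lambda>z. \<lambda>d\<in>{..<D}. (\<Sum>s<S. z (d, s)) / real S) \<in> measurable ?PZ ?P"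
    by (intro measurable_restrict borel_measurable_divide borel_measurable_sum measurable_component_singleton) auto
  have F_eq: "F \<omega> = (\<lambda>i\<in>{..<Suc D}. path_on X f \<omega> (?p i))" for \<omega>
    unfolding F_def path_on_def by (rule restrict_ext) (use points in \<open>simp only: lessThan_iff image_subset_iff restrict_apply' Ball_def\<close>)
  have H_eq: "H \<omega> = (\<lambda>i\<in>{..<D}. path_on X (log_var g) \<omega> (xs i))" for \<omega>
    unfolding H_def path_on_def by (rule restrict_ext) (use xs_in in auto)
  have E_eq: "E \<omega> = (\<lambda>d\<in>{..<D}. (\<Sum>s<S. Z \<omega> (d, s)) / real S)" for \<omega>
    by (auto simp: E_def Z_def intro!: restrict_ext)

  have indep_F_H: "indep_maps ?PF F ?P H"
    unfolding F_eq[abs_def] H_eq[abs_def] by (intro indep_maps_compose[OF _ eval_F eval_H] indep_maps_if_indep_var indep_f_h)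
  have Z: "Z \<in> measurable M ?PZ"
    unfolding Z_def[abs_def]
  proof (intro measurable_restrict)
    fix p assume "p \<in> {..<D} \<times> {..<S}"
    then show "(\<lambda>\<omega>. case p of (d, s) \<Rightarrow> w d s \<omega> / g (xs d) \<omega>) \<in> borel_measurable M"
      using distributed_measurable[OF noise_normal] by auto
  qed
  have "indep_maps ?PZ Z (path_space X \<Otimes>\<^sub>M path_space X) (\<lambda>\<omega>. (path_on X f \<omega>, path_on X (log_var g) \<omega>))"
    using noise_indep_f_h paths Z unfolding Z_def[abs_def] by (intro indep_maps_if_indep_set) auto
  then have paths_Z: "indep_maps (path_space X \<Otimes>\<^sub>M path_space X) (\<lambda>\<omega>. (path_on X f \<omega>, path_on X (log_var g) \<omega>)) ?PZ Z"
    by (rule indep_maps_sym)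
  have eval_FH: "(\<lambda>q. (\<lambda>i\<in>{..<Suc D}. fst q (?p i), \<lambda>i\<in>{..<D}. snd q (xs i))) \<in> measurable (path_space X \<Otimes>\<^sub>M path_space X) (?PF \<Otimes>\<^sub>M ?P)"
    by (intro measurable_Pair measurable_compose[OF measurable_fst eval_F] measurable_compose[OF measurable_snd eval_H])
  have indep_FH_E: "indep_maps (?PF \<Otimes>\<^sub>M ?P) (\<lambda>\<omega>. (F \<omega>, H \<omega>)) ?P E"
    unfolding F_eq[abs_def] H_eq[abs_def] E_eq[abs_def]
    using indep_maps_compose[OF paths_Z eval_FH mean_Z] by (simp only: fst_conv snd_conv)
  have indep_F_E: "indep_maps ?PF F ?P E"
    using indep_maps_compose[OF indep_FH_E measurable_fst measurable_ident_sets[OF refl]] by simp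
  note F = indep_maps_rv(1)[OF indep_F_H] and H = indep_maps_rv(2)[OF indep_F_H]
    and E = indep_maps_rv(2)[OF indep_F_E]
  have mgf_F: "(\<integral>\<^sup>+\<omega>. ennreal (exp (\<Sum>i<Suc D. c i * F \<omega> i)) \<partial>M)
      = ennreal (exp ((\<Sum>i<Suc D. \<Sum>j<Suc D. c i * c j * k (?p i) (?p j)) / 2))" for c
    using gaussian_process_mgf[OF prob_space_axioms gp_f points, of c] by (simp add: F_def del: sum.lessThan_Suc)
  have mgf_E: "(\<integral>\<^sup>+\<omega>. ennreal (exp (\<Sum>d<D. c d * E \<omega> d)) \<partial>M) = ennreal (exp ((\<Sum>d<D. (c d)\<^sup>2 / real S) / 2))" for c
    using mean_std_normal_mgf[of S D "\<lambda>d s \<omega>. w d s \<omega> / g (xs d) \<omega>" c] noise_normal noise_indep S_pos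
    by (simp add: E_def)
  note key = conditional_prob_random_noise[OF prob_space_axioms F indep_F_E mgf_F mgf_E indep_F_H indep_FH_E]

  \<comment> \<open>The averaged outputs are the noisy values, since \<open>g = exp (h / 2)\<close>.\<close>
  define Y where "Y \<omega> = (\<lambda>d\<in>{..<D}. emp_mean S y d \<omega>)" for \<omega>
  have Y_eq: "Y \<omega> = noisy_values (H \<omega>) (F \<omega>) (E \<omega>)" if \<omega>: "\<omega> \<in> space M" for \<omega>
  proof -
    have "emp_mean S y d \<omega> = F \<omega> d + exp (H \<omega> d / 2) * E \<omega> d" if d: "d < D" for d
    proof -
      have g: "g (xs d) \<omega> > 0" using g_pos xs_in d \<omega> by auto
      then have "exp (H \<omega> d / 2) = g (xs d) \<omega>" using d by (simp add: H_def log_var_def ln_realpow)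
      moreover have "emp_mean S y d \<omega> = (\<Sum>s<S. f (xs d) \<omega> + w d s \<omega>) / real S"
        using obs d \<omega> by (simp add: emp_mean_def)
      ultimately show ?thesis
        using g d S_pos by (simp add: F_def E_def sum.distrib add_divide_distrib sum_divide_distrib[symmetric])
    qed
    then show ?thesis by (auto simp: Y_def noisy_values_def intro!: restrict_ext)
  qed
  have Y: "Y \<in> measurable M ?P"
    using measurable_noisy_values[OF H F E] by (subst measurable_cong[OF Y_eq])
  have alg: "data_algebra M D S y = vimage_algebra (space M) Y ?P"
    unfolding data_algebra_def Y_def[abs_def] by simp
  have sub: "subalgebra M (data_algebra M D S y)"
    unfolding subalgebra_def alg using Y by (auto simp: in_vimage_algebra sets_vimage_algebra2[OF measurable_space[OF Y, THEN funcsetI]] measurable_sets)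
  interpret finite_measure_subalgebra M "data_algebra M D S y"
    by unfold_locales (rule sub)

  let ?A = "{\<omega> \<in> space M. f x \<omega> \<le> \<gamma>}"
  let ?e = "\<lambda>\<omega>. erfc ((\<gamma> - post_mean k D S xs x (\<lambda>d. log_var g (xs d) \<omega>) (\<lambda>d. emp_mean S y d \<omega>))
                    / (sqrt 2 * sqrt (post_var k D S xs x (\<lambda>d. log_var g (xs d) \<omega>))))"
  let ?c = "\<lambda>\<omega>. cond_prob_le \<gamma> (H \<omega>) (Y \<omega>)"
  have e_eq: "?c \<omega> = 1 - ?e \<omega> / 2" for \<omega>
    using cond_prob_le_cong[of "H \<omega>" "\<lambda>d. log_var g (xs d) \<omega>" "Y \<omega>" "\<lambda>d. emp_mean S y d \<omega>" \<gamma>]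
    by (simp add: H_def Y_def cond_prob_le_def)
  have c_meas: "?c \<in> borel_measurable M" by (rule measurable_cond_prob_le[OF H Y])
  have c_bounds: "0 \<le> ?c \<omega>" "?c \<omega> \<le> 1" for \<omega>
    using erfc_bounds by (simp_all add: e_eq)
  have e_meas: "?e \<in> borel_measurable M"
  proof -
    have "?e = (\<lambda>\<omega>. 2 - 2 * ?c \<omega>)" by (simp add: e_eq)
    then show ?thesis using c_meas by simp
  qed
  have f_meas: "f x \<in> borel_measurable M" using gp_f x_in by (simp add: gaussian_process_def)
  then have A: "?A \<in> sets M" by measurable
  have int_A: "integrable M (indicat_real ?A)"
    using A by (intro integrable_const_bound[where B = 1]) (auto simp: indicator_def)
  have int_e: "integrable M ?e"
    by (rule integrable_const_bound[where B = 2, OF AE_I2 e_meas]) (simp add: erfc_bounds)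
  have int_c: "integrable M ?c"
    by (rule integrable_const_bound[where B = 1, OF AE_I2 c_meas]) (simp only: real_norm_def abs_of_nonneg[OF c_bounds(1)] c_bounds(2))
  \<comment> \<open>Events of the data algebra are events \<open>Y \<in> B'\<close>, on which the integrals are known to agree.\<close>
  have set_eq: "(LINT \<omega>:B|M. indicat_real ?A \<omega>) = (LINT \<omega>:B|M. ?c \<omega>)" if B: "B \<in> sets (data_algebra M D S y)" for B
  proof -
    have BM: "B \<in> sets M" using B sub by (auto simp: subalgebra_def)
    obtain B' where B': "B' \<in> sets ?P" "B = Y -` B' \<inter> space M"
      using B unfolding alg by (auto simp: sets_vimage_algebra2[OF measurable_space[OF Y, THEN funcsetI]])
    have mem: "\<omega> \<in> B \<longleftrightarrow> noisy_values (H \<omega>) (F \<omega>) (E \<omega>) \<in> B'" if "\<omega> \<in> space M" for \<omega>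
      using that B' Y_eq by auto
    have F_D: "F \<omega> D = f x \<omega>" for \<omega> by (simp add: F_def)
    have "ennreal (LINT \<omega>:B|M. indicat_real ?A \<omega>) = (\<integral>\<^sup>+\<omega>. ennreal (indicator B \<omega> *\<^sub>R indicat_real ?A \<omega>) \<partial>M)"
      unfolding set_lebesgue_integral_def using int_A BM
      by (intro nn_integral_eq_integral[symmetric] integrable_mult_indicator) auto
    also have "\<dots> = (\<integral>\<^sup>+\<omega>. indicator B' (noisy_values (H \<omega>) (F \<omega>) (E \<omega>)) * indicator {..\<gamma>} (F \<omega> D) \<partial>M)"
      by (intro nn_integral_cong) (simp add: F_D mem indicator_def)
    also have "\<dots> = (\<integral>\<^sup>+\<omega>. indicator B' (noisy_values (H \<omega>) (F \<omega>) (E \<omega>))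
             * ennreal (cond_prob_le \<gamma> (H \<omega>) (noisy_values (H \<omega>) (F \<omega>) (E \<omega>))) \<partial>M)"
      by (rule key[OF B'(1)])
    also have "\<dots> = (\<integral>\<^sup>+\<omega>. ennreal (indicator B \<omega> *\<^sub>R ?c \<omega>) \<partial>M)"
      by (intro nn_integral_cong) (simp add: mem Y_eq indicator_def)
    also have "\<dots> = ennreal (LINT \<omega>:B|M. ?c \<omega>)"
      unfolding set_lebesgue_integral_def using int_c BM c_bounds
      by (intro nn_integral_eq_integral integrable_mult_indicator) auto
    finally show ?thesis
      using c_bounds by (subst (asm) ennreal_inj) (auto simp: set_lebesgue_integral_def intro!: Bochner_Integration.integral_nonneg)
  qed
  have affine: "(LINT \<omega>:B|M. 1 - 1 / 2 * u \<omega>) = (LINT \<omega>:B|M. 1) - 1 / 2 * (LINT \<omega>:B|M. u \<omega>)"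
    if u: "integrable M u" and B: "B \<in> sets M" for u :: "'w \<Rightarrow> real" and B
  proof -
    have "set_integrable M B (\<lambda>_. 1 :: real)" "set_integrable M B (\<lambda>\<omega>. 1 / 2 * u \<omega>)"
      unfolding set_integrable_def by (rule integrable_mult_indicator[OF B]; simp add: u)+
    from set_integral_diff(2)[OF this] show ?thesis by (simp only: set_integral_mult_right)
  qed
  have "AE \<omega> in M. real_cond_exp M (data_algebra M D S y) (indicator ?A) \<omega>
      = 1 - 1 / 2 * real_cond_exp M (data_algebra M D S y) ?e \<omega>"
  proof (rule real_cond_exp_charact)
    fix B assume B: "B \<in> sets (data_algebra M D S y)"
    have BM: "B \<in> sets M" using B sub by (auto simp: subalgebra_def)
    have "(LINT \<omega>:B|M. indicat_real ?A \<omega>) = (LINT \<omega>:B|M. 1 - 1 / 2 * ?e \<omega>)"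
      using set_eq[OF B] by (simp add: e_eq)
    also have "\<dots> = (LINT \<omega>:B|M. 1) - 1 / 2 * (LINT \<omega>:B|M. ?e \<omega>)"
      by (rule affine[OF int_e BM])
    also have "(LINT \<omega>:B|M. ?e \<omega>) = (LINT \<omega>:B|M. real_cond_exp M (data_algebra M D S y) ?e \<omega>)"
      by (rule real_cond_exp_intA[OF int_e B])
    also have "(LINT \<omega>:B|M. 1) - 1 / 2 * \<dots>
        = (LINT \<omega>:B|M. 1 - 1 / 2 * real_cond_exp M (data_algebra M D S y) ?e \<omega>)"
      by (rule affine[OF real_cond_exp_int(1)[OF int_e] BM, symmetric])
    finally show "(LINT \<omega>:B|M. indicat_real ?A \<omega>)
        = (LINT \<omega>:B|M. 1 - 1 / 2 * real_cond_exp M (data_algebra M D S y) ?e \<omega>)" .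
  next
    show "integrable M (indicat_real ?A)" by (rule int_A)
    show "integrable M (\<lambda>\<omega>. 1 - 1 / 2 * real_cond_exp M (data_algebra M D S y) ?e \<omega>)"
      using real_cond_exp_int(1)[OF int_e] by simp
    show "(\<lambda>\<omega>. 1 - 1 / 2 * real_cond_exp M (data_algebra M D S y) ?e \<omega>) \<in> borel_measurable (data_algebra M D S y)"
      by measurable
  qed
  then show ?thesis unfolding delta_def .
qed

end
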